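(* Suppose $d\ge 3$ and $2\le k<d$. Let $E\subset\mathbb R^d$ be a compact set with $\dim(E)>\frac{d+k}{2}$, and let $\mu$ be an $s$-Frostman measure on $E$ with $s>\frac{d+k}{2}$. Let $E_1,\dots,E_{k+1}$ be pairwise separated compact subsets of $E$ with $\mu(E_i)>0$ for all $i=1,\dots,k+1$. Then for $\mu_{E_1}\times\cdots\times\mu_{E_k}$-almost every $(x_1,\dots,x_k)\in E_1\times\cdots\times E_k$, $$\mathcal L^{k-1}\Big(\big\{(\mathrm{Area}(x_1,x_2,y),\mathrm{Area}(x_2,x_3,y),\dots,\mathrm{Area}(x_{k-1},x_k,y)): y\in E_{k+1}\big\}\Big)>0.$$
   Context: $\dim$ is Hausdorff dimension and $\mathcal L^{k-1}$ is Lebesgue measure on $\mathbb R^{k-1}$. $\mathrm{Area}(x,y,z)$ is the area of the triangle with vertices $x,y,z$. An $s$-Frostman measure on a compact set $E\subset\mathbb R^d$ is a nonzero finite Borel measure $\mu$ supported on $E$ for which there is a constant $C$ with $\mu(B(x,r))\le Cr^s$ for all $x\in\mathbb R^d$, $r>0$. For compact $F\subset E$, $\mu_F$ is the restriction $\mu_F(A)=\mu(A\cap F)$. Sets are pairwise separated if any two are at positive distance. *)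

theory Defs
  imports "HOL-Analysis.Analysis"
begin

section \<open>Hausdorff dimension\<close>

text \<open>
  The weight \<open>(diam U)\<^sup>s\<close>, with the usual conventions at \<open>s = 0\<close>: it is 0 for the empty set
  and 1 for every non-empty set. The case distinction is needed because \<open>0 powr 0 = 0\<close>.
\<close>

definition diam_weight :: "real \<Rightarrow> 'a::metric_space set \<Rightarrow> ennreal" where
  "diam_weight s U =
     (if U = {} then 0 else if s = 0 then 1 else ennreal (diameter U powr s))"

text \<open>
  The covering sets are required to be bounded because \<^const>\<open>diameter\<close> is real-valued and
  carries no information for unbounded sets.
\<close>

definition hausdorff_premeasure :: "real \<Rightarrow> real \<Rightarrow> 'a::metric_space set \<Rightarrow> ennreal" where
  "hausdorff_premeasure s \<delta> A =
     Inf {(\<Sum>n. diam_weight s (U n)) | U :: nat \<Rightarrow> 'a set.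
            A \<subseteq> (\<Union>n. U n) \<and> (\<forall>n. bounded (U n) \<and> diameter (U n) \<le> \<delta>)}"

definition hausdorff_measure :: "real \<Rightarrow> 'a::metric_space set \<Rightarrow> ennreal" where
  "hausdorff_measure s A = (SUP \<delta>\<in>{0<..}. hausdorff_premeasure s \<delta> A)"

definition hausdorff_dim :: "'a::metric_space set \<Rightarrow> ereal" where
  "hausdorff_dim A = Inf {ereal s | s. 0 \<le> s \<and> hausdorff_measure s A = 0}"

section \<open>Frostman measures and restrictions\<close>

text \<open>
  Since \<open>E\<close> is closed, \<open>\<mu>\<close> being supported on \<open>E\<close> means that the complement of \<open>E\<close> is a null set.
\<close>

definition frostman_measure ::
    "real \<Rightarrow> 'a::euclidean_space set \<Rightarrow> 'a measure \<Rightarrow> bool" where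
  "frostman_measure s E \<mu> \<longleftrightarrow>
     compact E \<and> sets \<mu> = sets borel \<and> finite_measure \<mu> \<and>
     emeasure \<mu> (space \<mu>) \<noteq> 0 \<and> emeasure \<mu> (- E) = 0 \<and>
     (\<exists>C. \<forall>x r. 0 < r \<longrightarrow> measure \<mu> (ball x r) \<le> C * r powr s)"

text \<open>The restriction of \<open>\<mu>\<close> to \<open>F\<close>, as a measure on the same space as \<open>\<mu>\<close>.\<close>

definition restricted_measure :: "'a measure \<Rightarrow> 'a set \<Rightarrow> 'a measure" where
  "restricted_measure \<mu> F = density \<mu> (indicator F)"

lemma emeasure_restricted_measure:
  assumes "F \<in> sets \<mu>" "A \<in> sets \<mu>"
  shows "emeasure (restricted_measure \<mu> F) A = emeasure \<mu> (A \<inter> F)"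
  using assms by (simp add: restricted_measure_def emeasure_restricted Int_commute)

section \<open>Area of a triangle in Euclidean space\<close>

text \<open>Half of the base \<open>xy\<close> times the height over the line through \<open>x\<close> and \<open>y\<close>.\<close>

definition triangle_area :: "'a::euclidean_space \<Rightarrow> 'a \<Rightarrow> 'a \<Rightarrow> real" where
  "triangle_area x y z = dist x y * infdist z (affine hull {x, y}) / 2"

lemma triangle_area_eq_gram:
  "triangle_area x y z =
     sqrt ((norm (y - x))\<^sup>2 * (norm (z - x))\<^sup>2 - ((y - x) \<bullet> (z - x))\<^sup>2) / 2"
proof (cases "x = y")
  case True
  then show ?thesis by (simp add: triangle_area_def)
next
  case False
  define u v where "u = y - x" and "v = z - x"
  define t where "t = (u \<bullet> v) / (u \<bullet> u)"
  have u: "u \<bullet> u > 0" using False by (simp add: u_def)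
  have le: "norm (v - t *\<^sub>R u) \<le> norm (v - r *\<^sub>R u)" for r
  proof -
    have "(v - r *\<^sub>R u) \<bullet> (v - r *\<^sub>R u) - (v - t *\<^sub>R u) \<bullet> (v - t *\<^sub>R u) =
            (r\<^sup>2 - t\<^sup>2) * (u \<bullet> u) - 2 * (r - t) * (u \<bullet> v)"
      by (simp add: inner_diff_left inner_diff_right inner_commute power2_eq_square algebra_simps)
    also have "u \<bullet> v = t * (u \<bullet> u)" using u by (simp add: t_def)
    also have "(r\<^sup>2 - t\<^sup>2) * (u \<bullet> u) - 2 * (r - t) * (t * (u \<bullet> u)) = (r - t)\<^sup>2 * (u \<bullet> u)"
      by (simp add: power2_eq_square algebra_simps)
    also have "\<dots> \<ge> 0" by simp
    finally show ?thesis by (simp add: norm_le)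
  qed
  have aff: "affine hull {x, y} = range (\<lambda>r. x + r *\<^sub>R u)"
    by (simp add: affine_hull_2_alt u_def)
  have d: "dist z (x + r *\<^sub>R u) = norm (v - r *\<^sub>R u)" for r
    by (simp add: dist_norm v_def algebra_simps)
  have "infdist z (affine hull {x, y}) = norm (v - t *\<^sub>R u)"
  proof (rule antisym)
    show "infdist z (affine hull {x, y}) \<le> norm (v - t *\<^sub>R u)"
      using infdist_le[of "x + t *\<^sub>R u" "affine hull {x, y}" z] by (auto simp: aff d)
    show "norm (v - t *\<^sub>R u) \<le> infdist z (affine hull {x, y})"
      unfolding aff by (subst infdist_notempty) (auto intro!: cINF_greatest simp: d le)
  qed
  moreover have "dist x y = norm u"
    by (simp add: dist_norm norm_minus_commute u_def)
  ultimately have "dist x y * infdist z (affine hull {x, y}) =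
      sqrt ((u \<bullet> u) * ((v - t *\<^sub>R u) \<bullet> (v - t *\<^sub>R u)))"
    by (simp add: real_sqrt_mult norm_eq_sqrt_inner)
  also have "(u \<bullet> u) * ((v - t *\<^sub>R u) \<bullet> (v - t *\<^sub>R u)) = (u \<bullet> u) * (v \<bullet> v) - (u \<bullet> v)\<^sup>2"
    using u by (simp add: t_def inner_diff_left inner_diff_right inner_commute power2_eq_square
        field_simps)
  finally show ?thesis
    by (simp add: triangle_area_def u_def v_def power2_norm_eq_inner)
qed

lemma triangle_area_eq_measure:
  fixes x y z :: "real ^ 2"
  shows "triangle_area x y z = measure lborel (convex hull {x, y, z})"
proof -
  have "(norm (y - x))\<^sup>2 * (norm (z - x))\<^sup>2 - ((y - x) \<bullet> (z - x))\<^sup>2 =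
      ((z $ 1 - x $ 1) * (y $ 2 - x $ 2) - (y $ 1 - x $ 1) * (z $ 2 - x $ 2))\<^sup>2"
    unfolding power2_norm_eq_inner inner_vec_def sum_2 vector_minus_component inner_real_def
    by (simp add: power2_eq_square algebra_simps)
  then show ?thesis
    by (simp add: triangle_area_eq_gram content_triangle)
qed

end

theory Submission
  imports Defs "HOL-Probability.Probability" "HOL-Real_Asymp.Real_Asymp"
begin

text \<open>
  Write \<open>D\<^sub>i y = (norm (y - x\<^sub>i))\<^sup>2\<close>. By Heron's formula the area vector of \<open>y\<close> is the image of
  \<open>(D\<^sub>1 y, \<dots>, D\<^sub>k y)\<close> under a triangular map that pulls Lebesgue null sets back to null sets,
  so it suffices that the vectors \<open>(D\<^sub>1 y, \<dots>, D\<^sub>k y)\<close> with \<open>y\<close> in the last set form a set of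
  positive \<open>k\<close>-dimensional measure.

  For that, the image of the last measure under \<open>(D\<^sub>1, \<dots>, D\<^sub>k)\<close> should have a square integrable
  Fourier transform for almost every choice of pins. Fix a frequency \<open>\<xi>\<close>
  and let \<open>\<xi>\<^sub>j\<close> be its largest entry. As a function of \<open>y\<close>, the phase
  \<open>\<Sum>\<^sub>i \<xi>\<^sub>i D\<^sub>i y\<close> depends on \<open>x\<^sub>j\<close> only through \<open>- 2 \<xi>\<^sub>j (x\<^sub>j \<bullet> y)\<close>, so averaging over \<open>x\<^sub>j\<close>
  alone gives the squared modulus a mean of size \<open>\<bar>\<xi>\<^sub>j\<bar> powr (d - 2 * s)\<close>. This is integrable
  over \<open>k\<close>-dimensional frequency space exactly because \<open>2 * s > d + k\<close>.
\<close>

section \<open>Gaussian averages and Fourier transforms\<close>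

text \<open>Squared distances are used instead of areas because
  \<open>(norm (y - x))\<^sup>2\<close> couples a pin to \<open>y\<close> only through the bilinear
  term \<open>x \<bullet> y\<close>, so averaging over one pin is a mean square of an ordinary
  Fourier transform; the square root in the area would spoil this. Square integrability is never
  stated as such. Every frequency cutoff is a Gaussian, and since the Fourier transform of a
  Gaussian is again a Gaussian, each truncated square norm is literally a double integral of a
  Gaussian kernel over pairs of points. Fubini thus does the work of Plancherel. For
  \<open>k\<close> pins the truncated norm at scale \<open>n\<close> is, up to a constant,
  \<open>n ^ k * energy n\<close>. Its mean over the pins is bounded uniformly in \<open>n\<close>,
  and Fatou's lemma gives a finite liminf for almost every tuple of pins, that is, boundedness along
  a sequence of scales which may depend on the tuple. This suffices: a null image is already
  contradicted by arbitrarily small scales, and no density of the image measure has to be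
  constructed.\<close>

lemma borel_measurable_cis [measurable]: "cis \<in> borel_measurable borel"
  by (intro borel_measurable_continuous_onI continuous_intros)

lemma cis_sum: "cis (\<Sum>b\<in>B. f b) = (\<Prod>b\<in>B. cis (f b))"
  by (induction B rule: infinite_finite_induct) (auto simp flip: cis_mult)

text \<open>For \<open>R = 1\<close> this is the characteristic function of the standard normal law;
  the substitution \<open>x / R\<close> gives every other width.\<close>

lemma gaussian_fourier_real:
  fixes t R :: real
  assumes R: "R > 0"
  shows "has_bochner_integral lborel (\<lambda>x. cis (x * t) * of_real (exp (- x\<^sup>2 / (2 * R\<^sup>2))))
     (of_real (sqrt (2 * pi) * R * exp (- (R * t)\<^sup>2 / 2)))"
proof -
  have int: "integrable lborel (\<lambda>x::real. cis (x * u) * of_real (exp (- x\<^sup>2 / 2)))" for u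
  proof -
    have "integrable lborel (\<lambda>x. sqrt (2 * pi) * std_normal_density x)" by simp
    then have "integrable lborel (\<lambda>x::real. exp (- x\<^sup>2 / 2))"
      by (simp add: std_normal_density_def)
    then show ?thesis
      by (rule Bochner_Integration.integrable_bound) (auto simp: norm_mult)
  qed
  have val: "(\<integral>x. cis (x * u) * of_real (exp (- x\<^sup>2 / 2)) \<partial>lborel)
      = of_real (sqrt (2 * pi) * exp (- u\<^sup>2 / 2))" for u :: real
  proof -
    have "complex_of_real (exp (- u\<^sup>2 / 2)) = char std_normal_distribution u"
      by (simp add: char_std_normal_distribution)
    also have "\<dots> = (\<integral>x. std_normal_density x *\<^sub>R iexp (u * x) \<partial>lborel)"
      unfolding char_def by (subst integral_density) auto
    also have "\<dots> = (\<integral>x. of_real (1 / sqrt (2 * pi)) *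
        (cis (x * u) * of_real (exp (- x\<^sup>2 / 2))) \<partial>lborel)"
      by (intro Bochner_Integration.integral_cong)
         (auto simp: std_normal_density_def cis_conv_exp scaleR_conv_of_real mult_ac)
    also have "\<dots> = of_real (1 / sqrt (2 * pi)) *
        (\<integral>x. cis (x * u) * of_real (exp (- x\<^sup>2 / 2)) \<partial>lborel)"
      by (rule integral_mult_right_zero)
    finally show ?thesis by (simp add: field_simps)
  qed
  have "has_bochner_integral lborel (\<lambda>x::real. cis (x * (R * t)) * of_real (exp (- x\<^sup>2 / 2)))
     (of_real (sqrt (2 * pi) * exp (- (R * t)\<^sup>2 / 2)))"
    using int val by (simp add: has_bochner_integral_iff)
  from this[THEN lborel_has_bochner_integral_real_affine_iff[THEN iffD1, rotated], of "1 / R" 0]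
  show ?thesis using R
    by (simp add: field_simps scaleR_conv_of_real power_divide)
qed

text \<open>Character and Gaussian both factor over the coordinates in \<open>Basis\<close>, and
  \<open>lborel\<close> is the image of a product measure, so the one-dimensional formula multiplies
  up.\<close>

lemma gaussian_fourier:
  fixes y :: "'a::euclidean_space"
  assumes R: "R > 0"
  shows "has_bochner_integral lborel (\<lambda>z. cis (z \<bullet> y) * of_real (exp (- (norm z)\<^sup>2 / (2 * R\<^sup>2))))
     (of_real ((sqrt (2 * pi) * R) ^ DIM('a) * exp (- (R * norm y)\<^sup>2 / 2)))"
proof -
  interpret product_sigma_finite "\<lambda>b::'a. lborel :: real measure" ..
  define g where "g = (\<lambda>(b::'a) (x::real). cis (x * (y \<bullet> b)) * of_real (exp (- x\<^sup>2 / (2 * R\<^sup>2))))"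
  have g: "integrable lborel (g b)"
    "integral\<^sup>L lborel (g b) = of_real (sqrt (2 * pi) * R * exp (- (R * (y \<bullet> b))\<^sup>2 / 2))" for b
    using gaussian_fourier_real[OF R, of "y \<bullet> b"] by (auto simp: has_bochner_integral_iff g_def)
  define h where "h z = cis (z \<bullet> y) * of_real (exp (- (norm z)\<^sup>2 / (2 * R\<^sup>2)))" for z :: 'a
  have [measurable]: "h \<in> borel_measurable borel" unfolding h_def by measurable
  have hprod: "h (\<Sum>b\<in>Basis. f b *\<^sub>R b) = (\<Prod>b\<in>Basis. g b (f b))" for f
  proof -
    let ?z = "\<Sum>b\<in>Basis. f b *\<^sub>R b"
    have zb: "?z \<bullet> b = f b" if "b \<in> Basis" for b
      using that by simp
    have "?z \<bullet> y = (\<Sum>b\<in>Basis. f b * (y \<bullet> b))"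
      by (subst euclidean_inner) (auto intro!: sum.cong)
    moreover have "(norm ?z)\<^sup>2 = (\<Sum>b\<in>Basis. (f b)\<^sup>2)"
      unfolding power2_norm_eq_inner by (subst euclidean_inner) (auto intro!: sum.cong simp: power2_eq_square)
    ultimately show ?thesis
      by (simp add: h_def g_def prod.distrib cis_sum exp_sum sum_negf sum_divide_distrib
          flip: of_real_prod exp_sum)
  qed
  have *: "has_bochner_integral (\<Pi>\<^sub>M b\<in>Basis. lborel) (\<lambda>f. h (\<Sum>b\<in>(Basis::'a set). f b *\<^sub>R b))
     (\<Prod>b\<in>(Basis::'a set). integral\<^sup>L lborel (g b))"
    unfolding hprod has_bochner_integral_iff
    by (auto intro!: product_integrable_prod product_integral_prod g)
  have "has_bochner_integral lborel h (\<Prod>b\<in>(Basis::'a set). integral\<^sup>L lborel (g b))"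
    unfolding lborel_eq[where 'a='a] by (subst has_bochner_integral_distr) (use * in auto)
  also have "(\<Prod>b\<in>(Basis::'a set). integral\<^sup>L lborel (g b)) =
     of_real ((sqrt (2 * pi) * R) ^ DIM('a) * exp (- (R * norm y)\<^sup>2 / 2))"
  proof -
    have "(R * norm y)\<^sup>2 = (\<Sum>b\<in>Basis. (R * (y \<bullet> b))\<^sup>2)"
      unfolding power_mult_distrib power2_norm_eq_inner
      by (subst euclidean_inner) (auto simp: sum_distrib_left power2_eq_square)
    then show ?thesis
      by (simp add: g prod.distrib sum_negf sum_divide_distrib flip: of_real_prod exp_sum)
  qed
  finally show ?thesis by (simp add: h_def[abs_def])
qed

section \<open>Measures with power ball growth tested against Gaussians\<close>

lemma summable_gaussian_weight: "summable (\<lambda>j::nat. exp (- (real j)\<^sup>2) * (real j + 1) powr s)"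
proof (rule summable_comparison_test_bigo)
  show "summable (\<lambda>j::nat. norm (1 / real j ^ 2))"
    using inverse_power_summable[of 2, where 'a=real] by (simp add: inverse_eq_divide)
  show "(\<lambda>j::nat. exp (- (real j)\<^sup>2) * (real j + 1) powr s) \<in> O(\<lambda>j. 1 / real j ^ 2)"
    by real_asymp
qed

text \<open>Finiteness and ball growth pass to restrictions of a measure, so one pair
  \<open>C\<close>, \<open>s\<close> serves all the sets involved. The sign of \<open>C\<close> is
  left free, hence the \<open>\<bar>C\<bar>\<close> in the estimates.\<close>

locale ball_growth = finite_measure \<mu> for \<mu> :: "'a::euclidean_space measure" +
  fixes C s :: real
  assumes sets_eq [measurable_cong, simp]: "sets \<mu> = sets borel"
    and growth: "\<And>x r. 0 < r \<Longrightarrow> emeasure \<mu> (ball x r) \<le> ennreal (C * r powr s)"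
begin

text \<open>Cut space into shells on which \<open>R * norm (x - z)\<close> has integer part
  \<open>j\<close>. Such a shell lies in a ball of radius \<open>(j + 1) / R\<close>, of mass at
  most \<open>\<bar>C\<bar> * ((j + 1) / R) powr s\<close>, and the factor
  \<open>exp (- j\<^sup>2)\<close> makes the sum over \<open>j\<close> converge.\<close>

lemma gaussian_average:
  assumes R: "R > 0"
  shows "(\<integral>\<^sup>+x. exp (- (R * norm (x - z))\<^sup>2) \<partial>\<mu>)
    \<le> ennreal (\<bar>C\<bar> * (\<Sum>j. exp (- (real j)\<^sup>2) * (real j + 1) powr s) * R powr (-s))"
proof -
  define w where "w j = exp (- (real j)\<^sup>2) * (real j + 1) powr s" for j :: nat
  have w0: "0 \<le> w j" for j by (simp add: w_def)
  define B where "B j = ball z ((real j + 1) / R)" for j :: nat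
  have [measurable]: "B j \<in> sets borel" for j by (simp add: B_def)
  have "(\<integral>\<^sup>+x. exp (- (R * norm (x - z))\<^sup>2) \<partial>\<mu>)
      \<le> (\<integral>\<^sup>+x. (\<Sum>j. ennreal (exp (- (real j)\<^sup>2)) * indicator (B j) x) \<partial>\<mu>)"
  proof (rule nn_integral_mono)
    fix x
    define j where "j = nat \<lfloor>R * norm (x - z)\<rfloor>"
    have j: "real j \<le> R * norm (x - z)" "R * norm (x - z) < real j + 1"
      using R by (auto simp: j_def)
    have "ennreal (exp (- (R * norm (x - z))\<^sup>2)) \<le> ennreal (exp (- (real j)\<^sup>2)) * indicator (B j) x"
      using j R power_mono[OF j(1), of 2]
      by (auto simp: B_def dist_norm norm_minus_commute field_simps intro!: ennreal_leI)
    also have "\<dots> = (\<Sum>j\<in>{j}. ennreal (exp (- (real j)\<^sup>2)) * indicator (B j) x)"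
      by (simp only: sum.insert finite.emptyI empty_iff sum.empty add_0_right not_False_eq_True)
    also have "\<dots> \<le> (\<Sum>j. ennreal (exp (- (real j)\<^sup>2)) * indicator (B j) x)"
      by (rule sum_le_suminf) auto
    finally show "ennreal (exp (- (R * norm (x - z))\<^sup>2)) \<le> \<dots>" .
  qed
  also have "\<dots> = (\<Sum>j. ennreal (exp (- (real j)\<^sup>2)) * emeasure \<mu> (B j))"
    by (subst nn_integral_suminf) (auto simp: nn_integral_cmult_indicator)
  also have "\<dots> \<le> (\<Sum>j. ennreal (\<bar>C\<bar> * R powr (-s) * w j))"
  proof (rule suminf_le)
    fix j
    have "emeasure \<mu> (B j) \<le> ennreal (C * ((real j + 1) / R) powr s)"
      unfolding B_def by (rule growth) (use R in auto)
    also have "\<dots> \<le> ennreal (\<bar>C\<bar> * ((real j + 1) / R) powr s)"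
      by (intro ennreal_leI mult_right_mono) auto
    finally have "ennreal (exp (- (real j)\<^sup>2)) * emeasure \<mu> (B j)
        \<le> ennreal (exp (- (real j)\<^sup>2)) * ennreal (\<bar>C\<bar> * ((real j + 1) / R) powr s)"
      by (intro mult_left_mono) auto
    also have "\<dots> = ennreal (\<bar>C\<bar> * R powr (-s) * w j)"
      using R by (simp add: w_def powr_divide powr_minus field_simps flip: ennreal_mult)
    finally show "ennreal (exp (- (real j)\<^sup>2)) * emeasure \<mu> (B j) \<le> ennreal (\<bar>C\<bar> * R powr (-s) * w j)" .
  qed auto
  also have "\<dots> = ennreal (\<bar>C\<bar> * R powr (-s) * (\<Sum>j. w j))"
    using summable_gaussian_weight[of s, folded w_def]
    by (subst suminf_ennreal_eq[where x="\<bar>C\<bar> * R powr (-s) * (\<Sum>j. w j)"])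
       (auto intro!: sums_mult summable_sums w0 mult_nonneg_nonneg)
  finally show ?thesis by (simp add: w_def mult_ac)
qed

end

lemma borel_measurable_cnj [measurable]: "cnj \<in> borel_measurable borel"
  by (intro borel_measurable_continuous_onI continuous_intros)

text \<open>A majorant in \<open>x\<close> alone is integrable over the product because
  \<open>N\<close> is finite; \<open>M\<close> may then be Lebesgue measure on the frequency
  side.\<close>

lemma Fubini_dominated:
  fixes f :: "'a \<Rightarrow> 'b \<Rightarrow> 'c::{banach, second_countable_topology}"
  assumes "sigma_finite_measure M" "finite_measure N"
    and meas [measurable]: "case_prod f \<in> borel_measurable (M \<Otimes>\<^sub>M N)"
    and g: "integrable M g" and bound: "\<And>x y. norm (f x y) \<le> g x"
  shows "(\<integral>y. (\<integral>x. f x y \<partial>M) \<partial>N) = (\<integral>x. (\<integral>y. f x y \<partial>N) \<partial>M)"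
proof -
  interpret M: sigma_finite_measure M by fact
  interpret N: finite_measure N by fact
  interpret pair_sigma_finite M N ..
  note [measurable] = borel_measurable_integrable[OF g]
  have *: "integrable (M \<Otimes>\<^sub>M N) (case_prod f)"
  proof (rule integrableI_bounded)
    have "(\<integral>\<^sup>+p. ennreal (norm (case_prod f p)) \<partial>(M \<Otimes>\<^sub>M N)) \<le> (\<integral>\<^sup>+p. ennreal (g (fst p)) \<partial>(M \<Otimes>\<^sub>M N))"
      using bound by (intro nn_integral_mono) (auto intro!: ennreal_leI)
    also have "\<dots> = (\<integral>\<^sup>+x. ennreal (g x) * emeasure N (space N) \<partial>M)"
      by (subst N.nn_integral_fst[symmetric]) auto
    also have "\<dots> = (\<integral>\<^sup>+x. ennreal (g x) \<partial>M) * emeasure N (space N)"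
      by (rule nn_integral_multc) auto
    also have "\<dots> < \<infinity>"
    proof -
      have "(\<integral>\<^sup>+x. ennreal (g x) \<partial>M) \<le> (\<integral>\<^sup>+x. ennreal (norm (g x)) \<partial>M)"
        by (intro nn_integral_mono ennreal_leI) auto
      also have "\<dots> < \<infinity>" using g by (simp add: integrable_iff_bounded)
      finally show ?thesis
        by (simp add: ennreal_mult_less_top N.emeasure_eq_measure)
    qed
    finally show "(\<integral>\<^sup>+p. ennreal (norm (case_prod f p)) \<partial>(M \<Otimes>\<^sub>M N)) < \<infinity>" .
  qed simp
  show "(\<integral>y. (\<integral>x. f x y \<partial>M) \<partial>N) = (\<integral>x. (\<integral>y. f x y \<partial>N) \<partial>M)"
    using Fubini_integral[OF *] .
qed

lemma (in finite_measure) integrable_bounded: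
  fixes f :: "'a \<Rightarrow> 'b::{banach, second_countable_topology}"
  assumes "f \<in> borel_measurable M" "\<And>x. norm (f x) \<le> B"
  shows "integrable M f"
  using assms by (intro integrable_const_bound[of _ B]) auto

lemma (in finite_measure) norm_integral_bounded:
  fixes f :: "'a \<Rightarrow> 'b::{banach, second_countable_topology}"
  assumes "f \<in> borel_measurable M" "\<And>x. norm (f x) \<le> B"
  shows "norm (\<integral>x. f x \<partial>M) \<le> B * measure M (space M)"
proof -
  have "norm (\<integral>x. f x \<partial>M) \<le> (\<integral>x. norm (f x) \<partial>M)"
    by (rule integral_norm_bound)
  also have "\<dots> \<le> (\<integral>x. B \<partial>M)"
    using assms integrable_bounded[OF assms] by (intro integral_mono) auto
  finally show ?thesis by (simp add: mult.commute)
qed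

text \<open>
  Expanding the square turns the left-hand side into a double integral whose inner integral over
  \<open>z\<close> is the Fourier transform of a Gaussian, so only pairs at distance at most about \<open>1 / R\<close>
  contribute.
\<close>

lemma (in ball_growth) gaussian_energy:
  fixes G :: "'a \<Rightarrow> complex"
  assumes R: "R > 0" and [measurable]: "G \<in> borel_measurable borel" and B: "\<And>y. norm (G y) \<le> B"
  shows "(\<integral>\<^sup>+z. ennreal ((norm (\<integral>y. cis (z \<bullet> y) * G y \<partial>\<mu>))\<^sup>2 * exp (- (norm z)\<^sup>2 / (2 * R\<^sup>2))) \<partial>lborel)
    \<le> ennreal (B\<^sup>2 * (sqrt (2 * pi) * R) ^ DIM('a)) *
        (\<integral>\<^sup>+y. (\<integral>\<^sup>+y'. exp (- (R * norm (y' - y))\<^sup>2 / 2) \<partial>\<mu>) \<partial>\<mu>)"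
proof -
  define e where "e z = exp (- (norm z)\<^sup>2 / (2 * R\<^sup>2))" for z :: 'a
  define H where "H z = (\<integral>y. cis (z \<bullet> y) * G y \<partial>\<mu>)" for z
  define K where "K z p = cis (z \<bullet> fst p) * G (fst p) * cnj (cis (z \<bullet> snd p) * G (snd p)) * of_real (e z)"
    for z p
  define c where "c = (sqrt (2 * pi) * R) ^ DIM('a)"
  have c: "c \<ge> 0" using R by (simp add: c_def)
  have B0: "B \<ge> 0" using B[of 0] norm_ge_zero order_trans by blast
  interpret P: pair_sigma_finite \<mu> \<mu> ..
  interpret P: finite_measure "\<mu> \<Otimes>\<^sub>M \<mu>"
    by (rule finite_measure_pair_measure) unfold_locales
  have [measurable]: "e \<in> borel_measurable borel" unfolding e_def by measurable
  have e0: "e z \<ge> 0" for z by (simp add: e_def)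
  have [measurable]: "H \<in> borel_measurable borel" unfolding H_def by measurable
  have e_int: "integrable lborel e"
    using gaussian_fourier[OF R, of "0::'a"]
    by (simp add: has_bochner_integral_iff e_def[abs_def] complex_of_real_integrable_eq
        flip: of_real_exp)
  have Hb: "norm (H z) \<le> B * measure \<mu> (space \<mu>)" for z
    unfolding H_def by (rule norm_integral_bounded) (use B in \<open>auto simp: norm_mult\<close>)
  have He_int: "integrable lborel (\<lambda>z. (norm (H z))\<^sup>2 * e z)"
  proof (rule Bochner_Integration.integrable_bound)
    show "integrable lborel (\<lambda>z. (B * measure \<mu> (space \<mu>))\<^sup>2 * e z)"
      using e_int by simp
    show "AE z in lborel. norm ((norm (H z))\<^sup>2 * e z) \<le> norm ((B * measure \<mu> (space \<mu>))\<^sup>2 * e z)"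
      using Hb by (auto simp: e0 intro!: AE_I2 mult_right_mono power_mono)
  qed simp
  have K_meas [measurable]: "case_prod K \<in> borel_measurable (lborel \<Otimes>\<^sub>M (\<mu> \<Otimes>\<^sub>M \<mu>))"
    unfolding K_def by measurable
  have K_bound: "norm (K z p) \<le> B\<^sup>2 * e z" for z p
    using B0 by (auto simp: K_def norm_mult e0 power2_eq_square intro!: mult_mono B)
  have HK: "of_real ((norm (H z))\<^sup>2 * e z) = (\<integral>p. K z p \<partial>(\<mu> \<Otimes>\<^sub>M \<mu>))" for z
  proof -
    have "integrable (\<mu> \<Otimes>\<^sub>M \<mu>) (K z)"
      by (rule P.integrable_bounded[of _ "B\<^sup>2 * e z"]) (use K_bound in \<open>auto simp: K_def\<close>)
    then have "(\<integral>p. K z p \<partial>(\<mu> \<Otimes>\<^sub>M \<mu>)) = (\<integral>y. (\<integral>y'. K z (y, y') \<partial>\<mu>) \<partial>\<mu>)"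
      using P.integral_fst'[of "K z"] by simp
    also have "\<dots> = (\<integral>y. cis (z \<bullet> y) * G y * (cnj (H z) * of_real (e z)) \<partial>\<mu>)"
      by (intro Bochner_Integration.integral_cong)
         (simp_all add: K_def H_def mult.assoc del: complex_cnj_mult flip: integral_cnj)
    also have "\<dots> = H z * cnj (H z) * of_real (e z)"
      unfolding integral_mult_left_zero by (simp add: H_def[symmetric] mult.assoc)
    finally show ?thesis by (simp add: complex_norm_square[symmetric] flip: of_real_power)
  qed
  have inner: "(\<integral>z. K z p \<partial>lborel) =
      G (fst p) * cnj (G (snd p)) * of_real (c * exp (- (R * norm (snd p - fst p))\<^sup>2 / 2))" for p
  proof -
    have "K z p = G (fst p) * cnj (G (snd p)) * (cis (z \<bullet> (fst p - snd p)) * of_real (e z))" for z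
      by (simp add: K_def inner_diff_right cis_cnj flip: cis_mult cis_divide)
         (simp add: cis_divide field_simps flip: cis_inverse)
    then show ?thesis
      using gaussian_fourier[OF R, of "fst p - snd p"]
      by (simp add: has_bochner_integral_iff e_def c_def norm_minus_commute)
  qed
  have "ennreal (\<integral>z. (norm (H z))\<^sup>2 * e z \<partial>lborel) = ennreal (norm (\<integral>z. complex_of_real ((norm (H z))\<^sup>2 * e z) \<partial>lborel))"
    using e0 by (simp only: integral_complex_of_real norm_of_real) (simp add: integral_nonneg)
  also have "(\<integral>z. complex_of_real ((norm (H z))\<^sup>2 * e z) \<partial>lborel) = (\<integral>z. (\<integral>p. K z p \<partial>(\<mu> \<Otimes>\<^sub>M \<mu>)) \<partial>lborel)"
    by (simp only: HK)
  also have "\<dots> = (\<integral>p. (\<integral>z. K z p \<partial>lborel) \<partial>(\<mu> \<Otimes>\<^sub>M \<mu>))"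
    by (rule Fubini_dominated[symmetric, where g="\<lambda>z. B\<^sup>2 * e z"])
       (use e_int K_bound in \<open>auto intro: P.finite_measure_axioms sigma_finite_lborel\<close>)
  also have "\<dots> = (\<integral>p. G (fst p) * cnj (G (snd p)) * of_real (c * exp (- (R * norm (snd p - fst p))\<^sup>2 / 2)) \<partial>(\<mu> \<Otimes>\<^sub>M \<mu>))"
    by (simp only: inner)
  also have "ennreal (norm \<dots>) \<le> (\<integral>\<^sup>+p. ennreal (norm (G (fst p) * cnj (G (snd p)) * of_real (c * exp (- (R * norm (snd p - fst p))\<^sup>2 / 2)))) \<partial>(\<mu> \<Otimes>\<^sub>M \<mu>))"
    by (rule integral_norm_bound_ennreal, rule P.integrable_bounded[of _ "B * B * (c * 1)"])
       (use B0 c in \<open>auto simp: norm_mult intro!: mult_mono mult_left_le B\<close>)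
  also have "\<dots> \<le> (\<integral>\<^sup>+p. ennreal (B\<^sup>2 * c) * ennreal (exp (- (R * norm (snd p - fst p))\<^sup>2 / 2)) \<partial>(\<mu> \<Otimes>\<^sub>M \<mu>))"
  proof (rule nn_integral_mono)
    fix p
    have "norm (G (fst p) * cnj (G (snd p)) * complex_of_real (c * exp (- (R * norm (snd p - fst p))\<^sup>2 / 2)))
        \<le> B * B * (c * exp (- (R * norm (snd p - fst p))\<^sup>2 / 2))"
      using B0 c by (auto simp: norm_mult abs_mult intro!: mult_mono B)
    then have "norm (G (fst p) * cnj (G (snd p)) * complex_of_real (c * exp (- (R * norm (snd p - fst p))\<^sup>2 / 2)))
        \<le> B\<^sup>2 * c * exp (- (R * norm (snd p - fst p))\<^sup>2 / 2)"
      by (simp only: power2_eq_square mult.assoc)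
    then have "ennreal (norm (G (fst p) * cnj (G (snd p)) * complex_of_real (c * exp (- (R * norm (snd p - fst p))\<^sup>2 / 2))))
        \<le> ennreal (B\<^sup>2 * c * exp (- (R * norm (snd p - fst p))\<^sup>2 / 2))"
      by (rule ennreal_leI)
    also have "\<dots> = ennreal (B\<^sup>2 * c) * ennreal (exp (- (R * norm (snd p - fst p))\<^sup>2 / 2))"
      using c by (intro ennreal_mult) auto
    finally show "ennreal (norm (G (fst p) * cnj (G (snd p)) * complex_of_real (c * exp (- (R * norm (snd p - fst p))\<^sup>2 / 2))))
        \<le> \<dots>" .
  qed
  also have "\<dots> = ennreal (B\<^sup>2 * c) * (\<integral>\<^sup>+y. (\<integral>\<^sup>+y'. exp (- (R * norm (y' - y))\<^sup>2 / 2) \<partial>\<mu>) \<partial>\<mu>)"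
    by (subst nn_integral_cmult, simp, subst nn_integral_fst[symmetric]) auto
  finally show ?thesis
    using He_int e0 by (subst nn_integral_eq_integral) (auto simp: H_def e_def c_def)
qed

text \<open>
  Multiplying a measure by a Gaussian convolves its Fourier transform with a Gaussian; hence the
  transform is essentially constant at unit scale.
\<close>

lemma (in ball_growth) gaussian_smoothing:
  fixes G :: "'a \<Rightarrow> complex"
  assumes [measurable]: "G \<in> borel_measurable borel" and B: "\<And>y. norm (G y) \<le> B"
  shows "ennreal ((norm (\<integral>y. cis (x \<bullet> y) * (of_real (exp (- (norm y)\<^sup>2 / 2)) * G y) \<partial>\<mu>))\<^sup>2)
    \<le> ennreal (1 / sqrt (2 * pi) ^ DIM('a)) *
      (\<integral>\<^sup>+z. exp (- (norm (z - x))\<^sup>2 / 2) * ennreal ((norm (\<integral>y. cis (z \<bullet> y) * G y \<partial>\<mu>))\<^sup>2) \<partial>lborel)"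
proof -
  define e where "e z = exp (- (norm (z - x))\<^sup>2 / 2)" for z
  define H where "H z = (\<integral>y. cis (z \<bullet> y) * G y \<partial>\<mu>)" for z
  define c where "c = sqrt (2 * pi) ^ DIM('a)"
  have c: "c > 0" by (simp add: c_def)
  have [measurable]: "e \<in> borel_measurable borel" unfolding e_def by measurable
  have [measurable]: "H \<in> borel_measurable borel" unfolding H_def by measurable
  have e0: "e z \<ge> 0" for z by (simp add: e_def)
  have shift: "has_bochner_integral lborel (\<lambda>z. cis (z \<bullet> y) * of_real (e z))
      (cis (x \<bullet> y) * of_real (c * exp (- (norm y)\<^sup>2 / 2)))" for y
  proof -
    have "has_bochner_integral lborel (\<lambda>z. cis (x \<bullet> y) * (cis (z \<bullet> y) * of_real (exp (- (norm z)\<^sup>2 / 2))))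
      (cis (x \<bullet> y) * of_real (c * exp (- (norm y)\<^sup>2 / 2)))"
      using gaussian_fourier[of 1 y] by (intro has_bochner_integral_mult_right) (simp add: c_def)
    then have "has_bochner_integral lborel (\<lambda>z. cis ((x + z) \<bullet> y) * of_real (e (x + z)))
      (cis (x \<bullet> y) * of_real (c * exp (- (norm y)\<^sup>2 / 2)))"
      by (simp add: e_def inner_add_left mult.assoc flip: cis_mult)
    then have "has_bochner_integral (distr lborel borel ((+) x)) (\<lambda>z. cis (z \<bullet> y) * of_real (e z))
      (cis (x \<bullet> y) * of_real (c * exp (- (norm y)\<^sup>2 / 2)))"
      by (subst has_bochner_integral_distr) auto
    then show ?thesis by (simp add: lborel_distr_plus)
  qed
  have e_int: "has_bochner_integral lborel e c"
    using has_bochner_integral_Re[OF shift[of 0]] by simp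
  have B0: "B \<ge> 0" using B[of 0] norm_ge_zero order_trans by blast
  have Hb: "norm (H z) \<le> B * measure \<mu> (space \<mu>)" for z
    unfolding H_def by (rule norm_integral_bounded) (use B in \<open>auto simp: norm_mult\<close>)
  have "of_real c * (\<integral>y. cis (x \<bullet> y) * (of_real (exp (- (norm y)\<^sup>2 / 2)) * G y) \<partial>\<mu>)
      = (\<integral>y. (\<integral>z. cis (z \<bullet> y) * of_real (e z) * G y \<partial>lborel) \<partial>\<mu>)"
    using shift by (simp add: has_bochner_integral_iff mult_ac flip: integral_mult_right_zero)
  also have "\<dots> = (\<integral>z. (\<integral>y. cis (z \<bullet> y) * of_real (e z) * G y \<partial>\<mu>) \<partial>lborel)"
  proof (rule Fubini_dominated[where g="\<lambda>z. B * e z"])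
    show "norm (cis (z \<bullet> y) * of_real (e z) * G y) \<le> B * e z" for z y
      using mult_right_mono[OF B[of y] e0[of z]] by (simp add: norm_mult e0 mult_ac)
  qed (use e_int in \<open>auto simp: has_bochner_integral_iff intro: sigma_finite_lborel finite_measure_axioms\<close>)
  also have "\<dots> = (\<integral>z. of_real (e z) * H z \<partial>lborel)"
    by (simp add: H_def mult_ac flip: integral_mult_right_zero)
  finally have *: "of_real c * (\<integral>y. cis (x \<bullet> y) * (of_real (exp (- (norm y)\<^sup>2 / 2)) * G y) \<partial>\<mu>) = \<dots>" .
  have eH: "integrable lborel (\<lambda>z. of_real (e z) * H z)"
  proof (rule Bochner_Integration.integrable_bound)
    show "integrable lborel (\<lambda>z. e z * (B * measure \<mu> (space \<mu>)))"
      using e_int by (simp add: has_bochner_integral_iff)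
    show "AE z in lborel. norm (of_real (e z) * H z) \<le> norm (e z * (B * measure \<mu> (space \<mu>)))"
      using Hb B0 by (auto simp: e0 norm_mult intro!: AE_I2 mult_left_mono)
  qed simp
  define I where "I = norm (\<integral>y. cis (x \<bullet> y) * (of_real (exp (- (norm y)\<^sup>2 / 2)) * G y) \<partial>\<mu>)"
  have "ennreal (c * I) = ennreal (norm (\<integral>z. of_real (e z) * H z \<partial>lborel))"
    using c by (simp add: I_def norm_mult flip: *)
  also have "\<dots> \<le> (\<integral>\<^sup>+z. ennreal (norm (of_real (e z) * H z)) \<partial>lborel)"
    by (rule integral_norm_bound_ennreal[OF eH])
  \<comment> \<open>The Gaussian is split into two square roots, so that Cauchy-Schwarz leaves its
    total mass \<open>c\<close> as one factor and the weighted square integral as the other.\<close>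
  also have "\<dots> = (\<integral>\<^sup>+z. ennreal (sqrt (e z)) * ennreal (sqrt (e z) * norm (H z)) \<partial>lborel)"
    using e0 by (intro nn_integral_cong) (simp add: norm_mult mult.assoc[symmetric] flip: ennreal_mult)
  finally have "(ennreal (c * I))\<^sup>2 \<le> \<dots>\<^sup>2" by (intro power_mono) auto
  also have "\<dots> \<le> (\<integral>\<^sup>+z. (ennreal (sqrt (e z)))\<^sup>2 \<partial>lborel) * (\<integral>\<^sup>+z. (ennreal (sqrt (e z) * norm (H z)))\<^sup>2 \<partial>lborel)"
    by (rule Cauchy_Schwarz_nn_integral) auto
  also have "(\<integral>\<^sup>+z. (ennreal (sqrt (e z)))\<^sup>2 \<partial>lborel) = ennreal c"
    using e_int e0 by (simp add: ennreal_power nn_integral_eq_integral has_bochner_integral_iff)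
  also have "(\<integral>\<^sup>+z. (ennreal (sqrt (e z) * norm (H z)))\<^sup>2 \<partial>lborel) =
      (\<integral>\<^sup>+z. e z * ennreal ((norm (H z))\<^sup>2) \<partial>lborel)"
    using e0 by (intro nn_integral_cong) (simp add: ennreal_power power_mult_distrib flip: ennreal_mult)
  finally have "ennreal ((c * I)\<^sup>2) \<le> ennreal c * (\<integral>\<^sup>+z. e z * ennreal ((norm (H z))\<^sup>2) \<partial>lborel)"
    using c by (simp add: ennreal_power I_def)
  then have "ennreal (1 / c\<^sup>2) * ennreal ((c * I)\<^sup>2) \<le> ennreal (1 / c\<^sup>2) * (ennreal c * (\<integral>\<^sup>+z. e z * ennreal ((norm (H z))\<^sup>2) \<partial>lborel))"
    by (rule mult_left_mono) auto
  also have "ennreal (1 / c\<^sup>2) * ennreal ((c * I)\<^sup>2) = ennreal (I\<^sup>2)"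
    using c by (simp add: power_mult_distrib flip: ennreal_mult)
  also have "ennreal (1 / c\<^sup>2) * (ennreal c * (\<integral>\<^sup>+z. e z * ennreal ((norm (H z))\<^sup>2) \<partial>lborel))
     = ennreal (1 / c) * (\<integral>\<^sup>+z. e z * ennreal ((norm (H z))\<^sup>2) \<partial>lborel)"
    using c by (simp add: power2_eq_square mult.assoc[symmetric] flip: ennreal_mult)
  finally show ?thesis by (simp add: I_def e_def c_def H_def)
qed

section \<open>The oscillatory estimate\<close>

text \<open>
  The exponent: averaging over \<open>\<mu>1\<close>, dilated by \<open>R\<close>, instead of over Lebesgue measure
  gains \<open>R powr (- s)\<close>, and the Gaussian energy at scale \<open>1 / R\<close> is at most
  \<open>R ^ d * R powr (- s)\<close>. The bound is uniform in \<open>f\<close>, so all terms of the phase that do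
  not involve \<open>x\<close> can be absorbed into \<open>f\<close>.
\<close>

lemma oscillatory_L2_bound:
  fixes \<mu>1 \<mu>2 :: "'a::euclidean_space measure"
  assumes g1: "ball_growth \<mu>1 C1 s" and g2: "ball_growth \<mu>2 C2 s"
    and M1: "AE x in \<mu>1. norm x \<le> M" and M2: "AE y in \<mu>2. norm y \<le> M"
  shows "\<exists>A\<ge>0. \<forall>R\<ge>1. \<forall>f\<in>borel_measurable borel. (\<forall>y. norm (f y) \<le> 1) \<longrightarrow>
    (\<integral>\<^sup>+x. ennreal ((norm (\<integral>y. cis (R * (x \<bullet> y)) * f y \<partial>\<mu>2))\<^sup>2) \<partial>\<mu>1)
      \<le> ennreal (A * R powr (real DIM('a) - 2 * s))"
proof -
  interpret m1: ball_growth \<mu>1 C1 s by fact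
  interpret m2: ball_growth \<mu>2 C2 s by fact
  define S where "S = (\<Sum>j. exp (- (real j)\<^sup>2) * (real j + 1) powr s)"
  define d where "d = DIM('a)"
  have S: "S \<ge> 0" unfolding S_def by (intro suminf_nonneg summable_gaussian_weight) auto
  define B where "B = exp (M\<^sup>2 / 2)"
  define k where "k = 1 / sqrt (2 * pi) ^ d"
  \<comment> \<open>In \<open>avg\<close> half of the exponent is kept for the average over
    \<open>\<mu>1\<close>, which therefore runs at parameter \<open>R / 2\<close>. The
    \<open>2\<close> and \<open>sqrt 2\<close> in \<open>A2\<close> come from using
    \<open>gaussian_energy\<close> with width \<open>2 * R\<close>.\<close>
  define A1 where "A1 = exp (M\<^sup>2 / 4) * (\<bar>C1\<bar> * S * (1 / 2) powr (-s))"
  define A2 where "A2 = B\<^sup>2 * (sqrt (2 * pi) * 2) ^ d * (\<bar>C2\<bar> * S * sqrt 2 powr (-s) * measure \<mu>2 (space \<mu>2))"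
  have pos: "k \<ge> 0" "A1 \<ge> 0" "A2 \<ge> 0" using S by (auto simp: k_def A1_def A2_def)
  have bound: "(\<integral>\<^sup>+x. ennreal ((norm (\<integral>y. cis (R * (x \<bullet> y)) * f y \<partial>\<mu>2))\<^sup>2) \<partial>\<mu>1)
      \<le> ennreal (k * A1 * A2 * R powr (real d - 2 * s))"
    if R: "R \<ge> 1" and [measurable]: "f \<in> borel_measurable borel" and f: "\<And>y. norm (f y) \<le> 1"
    for R and f :: "'a \<Rightarrow> complex"
  proof -
    \<comment> \<open>Cancels the weight \<open>exp (- (norm y)\<^sup>2 / 2)\<close> that smoothing
      puts on the integrand. The cutoff keeps \<open>G\<close> bounded and changes no integral, as
      \<open>\<mu>2\<close> is carried by the ball.\<close>
    define G where "G y = indicator (cball 0 M) y * of_real (exp ((norm y)\<^sup>2 / 2)) * f y" for y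
    have [measurable]: "cball 0 M \<in> sets (borel :: 'a measure)" by simp
    have [measurable]: "G \<in> borel_measurable borel" unfolding G_def by measurable
    have GB: "norm (G y) \<le> B" for y
    proof (cases "norm y \<le> M")
      case True
      then have "(norm y)\<^sup>2 \<le> M\<^sup>2" by (intro power_mono) auto
      then have "exp ((norm y)\<^sup>2 / 2) * norm (f y) \<le> B * 1"
        unfolding B_def by (intro mult_mono f) auto
      then show ?thesis using True by (simp add: G_def norm_mult)
    qed (auto simp: G_def B_def)
    define h where "h z = ennreal ((norm (\<integral>y. cis (z \<bullet> y) * G y \<partial>\<mu>2))\<^sup>2)" for z :: 'a
    have [measurable]: "h \<in> borel_measurable borel" unfolding h_def by measurable
    have eq: "(\<integral>y. cis (R * (x \<bullet> y)) * f y \<partial>\<mu>2)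
        = (\<integral>y. cis ((R *\<^sub>R x) \<bullet> y) * (of_real (exp (- (norm y)\<^sup>2 / 2)) * G y) \<partial>\<mu>2)" for x
      using M2 by (intro integral_cong_AE)
        (auto simp: G_def exp_minus field_simps simp flip: of_real_mult)
    \<comment> \<open>The exponent \<open>v\<^sup>2 / 2\<close> is halved: one half yields the decay
      \<open>R powr (- s)\<close>, the other is traded for a Gaussian in \<open>z\<close> of width
      \<open>2 * R\<close>. The trade uses that \<open>x\<close> is bounded, so
      \<open>norm z \<le> v + R * M\<close>, and that \<open>R \<ge> 1\<close>. The Gaussian in
      \<open>z\<close> is what turns the remaining integral into a Gaussian energy.\<close>
    have avg: "(\<integral>\<^sup>+x. exp (- (norm (z - R *\<^sub>R x))\<^sup>2 / 2) \<partial>\<mu>1)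
        \<le> ennreal (A1 * R powr (-s)) * exp (- (norm z)\<^sup>2 / (2 * (2 * R)\<^sup>2))" for z :: 'a
    proof -
      define u where "u = exp (M\<^sup>2 / 4) * exp (- (norm z)\<^sup>2 / (2 * (2 * R)\<^sup>2))"
      have "(\<integral>\<^sup>+x. exp (- (norm (z - R *\<^sub>R x))\<^sup>2 / 2) \<partial>\<mu>1)
        \<le> (\<integral>\<^sup>+x. ennreal u * exp (- (R / 2 * norm (x - z /\<^sub>R R))\<^sup>2) \<partial>\<mu>1)"
      proof (rule nn_integral_mono_AE, use M1 in eventually_elim)
        fix x :: 'a assume x: "norm x \<le> M"
        define v where "v = norm (z - R *\<^sub>R x)"
        have eqv: "R / 2 * norm (x - z /\<^sub>R R) = v / 2"
        proof -
          have "z - R *\<^sub>R x = - (R *\<^sub>R (x - z /\<^sub>R R))" using R by (simp add: scaleR_diff_right)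
          then show ?thesis using R by (simp add: v_def)
        qed
        have "norm z \<le> v + R * M"
        proof -
          have "norm z \<le> v + norm (R *\<^sub>R x)" unfolding v_def by (metis add.commute norm_triangle_sub)
          also have "norm (R *\<^sub>R x) \<le> R * M" using x R by simp
          finally show ?thesis by simp
        qed
        then have "(norm z)\<^sup>2 \<le> (v + R * M)\<^sup>2" by (intro power_mono) auto
        also have "\<dots> \<le> 2 * v\<^sup>2 + 2 * (R * M)\<^sup>2"
          using sum_squares_ge_zero[of "v - R * M" 0] by (simp add: power2_eq_square algebra_simps)
        finally have "(norm z)\<^sup>2 / (8 * R\<^sup>2) \<le> (2 * v\<^sup>2 + 2 * (R * M)\<^sup>2) / (8 * R\<^sup>2)"
          by (intro divide_right_mono) auto
        also have "\<dots> = v\<^sup>2 / (4 * R\<^sup>2) + M\<^sup>2 / 4" using R by (simp add: field_simps)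
        also have "\<dots> \<le> v\<^sup>2 / 4 + M\<^sup>2 / 4"
        proof -
          have "1 \<le> R\<^sup>2" using R by simp
          then have "v\<^sup>2 * 1 \<le> v\<^sup>2 * R\<^sup>2" by (intro mult_left_mono) auto
          then show ?thesis using R by (simp add: field_simps)
        qed
        finally have "- v\<^sup>2 / 2 \<le> M\<^sup>2 / 4 + - (norm z)\<^sup>2 / (2 * (2 * R)\<^sup>2) + - (v / 2)\<^sup>2"
          by (simp add: power_mult_distrib power_divide)
        then have "exp (- v\<^sup>2 / 2) \<le> exp (M\<^sup>2 / 4 + - (norm z)\<^sup>2 / (2 * (2 * R)\<^sup>2) + - (v / 2)\<^sup>2)"
          by (simp only: exp_le_cancel_iff)
        then have "exp (- v\<^sup>2 / 2) \<le> u * exp (- (v / 2)\<^sup>2)" by (simp only: exp_add u_def)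
        then show "ennreal (exp (- (norm (z - R *\<^sub>R x))\<^sup>2 / 2)) \<le>
            ennreal u * exp (- (R / 2 * norm (x - z /\<^sub>R R))\<^sup>2)"
          unfolding eqv by (simp add: v_def u_def flip: ennreal_mult)
      qed
      also have "\<dots> = ennreal u * (\<integral>\<^sup>+x. exp (- (R / 2 * norm (x - z /\<^sub>R R))\<^sup>2) \<partial>\<mu>1)"
        by (rule nn_integral_cmult) simp
      also have "\<dots> \<le> ennreal u * ennreal (\<bar>C1\<bar> * S * (R / 2) powr (-s))"
        unfolding S_def by (intro mult_left_mono m1.gaussian_average) (use R in auto)
      also have "\<dots> = ennreal (A1 * R powr (-s)) * exp (- (norm z)\<^sup>2 / (2 * (2 * R)\<^sup>2))"
        using S R powr_mult[of R "1/2" "-s"] by (simp add: u_def A1_def mult_ac flip: ennreal_mult)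
      finally show ?thesis .
    qed
    interpret P: pair_sigma_finite \<mu>1 "lborel :: 'a measure" ..
    have "(\<integral>\<^sup>+x. ennreal ((norm (\<integral>y. cis (R * (x \<bullet> y)) * f y \<partial>\<mu>2))\<^sup>2) \<partial>\<mu>1)
      \<le> (\<integral>\<^sup>+x. ennreal k * (\<integral>\<^sup>+z. exp (- (norm (z - R *\<^sub>R x))\<^sup>2 / 2) * h z \<partial>lborel) \<partial>\<mu>1)"
      unfolding eq h_def k_def d_def by (intro nn_integral_mono m2.gaussian_smoothing[OF _ GB]) simp
    also have "\<dots> = ennreal k * (\<integral>\<^sup>+x. (\<integral>\<^sup>+z. exp (- (norm (z - R *\<^sub>R x))\<^sup>2 / 2) * h z \<partial>lborel) \<partial>\<mu>1)"
      by (rule nn_integral_cmult) measurable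
    also have "(\<integral>\<^sup>+x. (\<integral>\<^sup>+z. exp (- (norm (z - R *\<^sub>R x))\<^sup>2 / 2) * h z \<partial>lborel) \<partial>\<mu>1)
        = (\<integral>\<^sup>+z. (\<integral>\<^sup>+x. exp (- (norm (z - R *\<^sub>R x))\<^sup>2 / 2) * h z \<partial>\<mu>1) \<partial>lborel)"
      by (rule P.Fubini'[symmetric]) measurable
    also have "\<dots> = (\<integral>\<^sup>+z. (\<integral>\<^sup>+x. exp (- (norm (z - R *\<^sub>R x))\<^sup>2 / 2) \<partial>\<mu>1) * h z \<partial>lborel)"
      by (intro nn_integral_cong nn_integral_multc) measurable
    also have "\<dots> \<le> (\<integral>\<^sup>+z. ennreal (A1 * R powr (-s)) * exp (- (norm z)\<^sup>2 / (2 * (2 * R)\<^sup>2)) * h z \<partial>lborel)"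
      by (intro nn_integral_mono mult_right_mono avg) auto
    also have "\<dots> = (\<integral>\<^sup>+z. ennreal (A1 * R powr (-s)) *
        ennreal ((norm (\<integral>y. cis (z \<bullet> y) * G y \<partial>\<mu>2))\<^sup>2 * exp (- (norm z)\<^sup>2 / (2 * (2 * R)\<^sup>2))) \<partial>lborel)"
      by (simp add: h_def ennreal_mult mult_ac)
    also have "\<dots> = ennreal (A1 * R powr (-s)) *
       (\<integral>\<^sup>+z. ennreal ((norm (\<integral>y. cis (z \<bullet> y) * G y \<partial>\<mu>2))\<^sup>2 * exp (- (norm z)\<^sup>2 / (2 * (2 * R)\<^sup>2))) \<partial>lborel)"
      by (rule nn_integral_cmult) measurable
    also have "\<dots> \<le> ennreal (A1 * R powr (-s)) * ennreal (A2 * R powr (real d - s))"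
    proof (rule mult_left_mono)
      have "(\<integral>\<^sup>+z. ennreal ((norm (\<integral>y. cis (z \<bullet> y) * G y \<partial>\<mu>2))\<^sup>2 * exp (- (norm z)\<^sup>2 / (2 * (2 * R)\<^sup>2))) \<partial>lborel)
        \<le> ennreal (B\<^sup>2 * (sqrt (2 * pi) * (2 * R)) ^ d) *
        (\<integral>\<^sup>+y. (\<integral>\<^sup>+y'. exp (- (2 * R * norm (y' - y))\<^sup>2 / 2) \<partial>\<mu>2) \<partial>\<mu>2)"
        unfolding d_def by (rule m2.gaussian_energy[OF _ _ GB]) (use R in auto)
      also have "\<dots> \<le> ennreal (B\<^sup>2 * (sqrt (2 * pi) * (2 * R)) ^ d) *
        (\<integral>\<^sup>+y. ennreal (\<bar>C2\<bar> * S * (sqrt 2 * R) powr (-s)) \<partial>\<mu>2)"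
      proof (intro mult_left_mono nn_integral_mono)
        fix y
        have "(2 * R * norm (y' - y))\<^sup>2 / 2 = (sqrt 2 * R * norm (y' - y))\<^sup>2" for y' :: 'a
          by (simp add: power_mult_distrib)
        then show "(\<integral>\<^sup>+y'. exp (- (2 * R * norm (y' - y))\<^sup>2 / 2) \<partial>\<mu>2) \<le> ennreal (\<bar>C2\<bar> * S * (sqrt 2 * R) powr (-s))"
          unfolding S_def using m2.gaussian_average[of "sqrt 2 * R" y] R by simp
      qed auto
      also have "\<dots> = ennreal (A2 * R powr (real d - s))"
        using R S by (simp add: A2_def powr_mult powr_diff powr_minus powr_realpow m2.emeasure_eq_measure
            power_mult_distrib mult_ac divide_inverse flip: ennreal_mult)
      finally show "(\<integral>\<^sup>+z. ennreal ((norm (\<integral>y. cis (z \<bullet> y) * G y \<partial>\<mu>2))\<^sup>2 * exp (- (norm z)\<^sup>2 / (2 * (2 * R)\<^sup>2))) \<partial>lborel)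
        \<le> \<dots>" .
    qed auto
    also have "\<dots> = ennreal (A1 * A2 * R powr (real d - 2 * s))"
      using pos R by (simp add: powr_diff powr_minus field_simps powr_add[symmetric] flip: ennreal_mult)
    finally show ?thesis using pos R
      by (simp add: mult_left_mono mult.assoc ennreal_mult)
  qed
  have "k * A1 * A2 \<ge> 0" using pos by simp
  with bound show ?thesis unfolding d_def by blast
qed

section \<open>Energies of pinned distance vectors\<close>

text \<open>Convergence of the frequency integral in a single coordinate; it is applied with
  \<open>a = decay / card I\<close>.\<close>

lemma nn_integral_max_powr_finite:
  assumes "a > 1"
  shows "(\<integral>\<^sup>+t. ennreal ((max 1 \<bar>t\<bar>) powr (- a)) \<partial>lborel) < \<infinity>"
proof -
  define f where "f t = t powr (- a)" for t :: real
  have half: "(\<integral>\<^sup>+t. ennreal (f t) * indicator {1..} t \<partial>lborel) = ennreal (0 - 1 powr (1 - a) / (1 - a))"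
  proof (rule nn_integral_FTC_atLeast[where F="\<lambda>t. t powr (1 - a) / (1 - a)"])
    show "((\<lambda>t. t powr (1 - a) / (1 - a)) has_real_derivative f t) (at t)" if "1 \<le> t" for t
      using that assms by (auto intro!: derivative_eq_intros simp: f_def)
    have "((\<lambda>t::real. t powr (1 - a)) \<longlongrightarrow> 0) at_top"
      using assms by (intro tendsto_neg_powr filterlim_ident) auto
    from tendsto_divide[OF this tendsto_const[of "1 - a"]] assms
    show "((\<lambda>t. t powr (1 - a) / (1 - a)) \<longlongrightarrow> 0) at_top" by simp
  qed (auto simp: f_def)
  have "(\<integral>\<^sup>+t. ennreal ((max 1 \<bar>t\<bar>) powr (- a)) \<partial>lborel)
    \<le> (\<integral>\<^sup>+t. indicator {-1..1} t + (ennreal (f t) * indicator {1..} t + ennreal (f (-t)) * indicator {1..} (-t)) \<partial>lborel)"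
    by (intro nn_integral_mono) (auto simp: f_def max_def indicator_def)
  also have "\<dots> = (\<integral>\<^sup>+t. indicator {-1..1} t \<partial>(lborel :: real measure)) +
      ((\<integral>\<^sup>+t. ennreal (f t) * indicator {1..} t \<partial>lborel) + (\<integral>\<^sup>+t. ennreal (f (-t)) * indicator {1..} (-t) \<partial>lborel))"
    by (subst nn_integral_add, simp, simp add: f_def, subst nn_integral_add) (auto simp: f_def)
  also have "(\<integral>\<^sup>+t. ennreal (f (-t)) * indicator {1..} (-t) \<partial>lborel) = (\<integral>\<^sup>+t. ennreal (f t) * indicator {1..} t \<partial>lborel)"
    using nn_integral_real_affine[of "\<lambda>t. ennreal (f t) * indicator {1..} t" "-1" 0] by (simp add: f_def)
  also have "(\<integral>\<^sup>+t. indicator {-1..1} t \<partial>(lborel :: real measure)) = 2"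
    by (subst nn_integral_indicator) auto
  also have "2 + ((\<integral>\<^sup>+t. ennreal (f t) * indicator {1..} t \<partial>lborel) + (\<integral>\<^sup>+t. ennreal (f t) * indicator {1..} t \<partial>lborel)) < \<infinity>"
    unfolding half by (simp add: ennreal_add_less_top)
  finally show ?thesis .
qed

text \<open>Conjugating the inner integral replaces \<open>R\<close> and \<open>f\<close> by
  \<open>- R\<close> and \<open>cnj f\<close> without changing its modulus, which reduces negative
  \<open>R\<close> to positive.\<close>

lemma oscillatory_L2_bound_signed:
  fixes \<mu>1 \<mu>2 :: "'a::euclidean_space measure"
  assumes g1: "ball_growth \<mu>1 C1 s" and g2: "ball_growth \<mu>2 C2 s"
    and M1: "AE x in \<mu>1. norm x \<le> M" and M2: "AE y in \<mu>2. norm y \<le> M"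
  shows "\<exists>A\<ge>0. \<forall>R f. 1 \<le> \<bar>R\<bar> \<longrightarrow> f \<in> borel_measurable borel \<longrightarrow> (\<forall>y. norm (f y) \<le> 1) \<longrightarrow>
    (\<integral>\<^sup>+x. ennreal ((norm (\<integral>y. cis (R * (x \<bullet> y)) * f y \<partial>\<mu>2))\<^sup>2) \<partial>\<mu>1)
      \<le> ennreal (A * \<bar>R\<bar> powr (real DIM('a) - 2 * s))"
proof -
  obtain A where A: "A \<ge> 0" and bound: "\<And>R f. 1 \<le> R \<Longrightarrow> f \<in> borel_measurable borel \<Longrightarrow> (\<forall>y. norm (f y) \<le> 1) \<Longrightarrow>
    (\<integral>\<^sup>+x. ennreal ((norm (\<integral>y. cis (R * (x \<bullet> y)) * f y \<partial>\<mu>2))\<^sup>2) \<partial>\<mu>1)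
      \<le> ennreal (A * R powr (real DIM('a) - 2 * s))"
    using oscillatory_L2_bound[OF assms] by blast
  have "(\<integral>\<^sup>+x. ennreal ((norm (\<integral>y. cis (R * (x \<bullet> y)) * f y \<partial>\<mu>2))\<^sup>2) \<partial>\<mu>1)
      \<le> ennreal (A * \<bar>R\<bar> powr (real DIM('a) - 2 * s))"
    if R: "1 \<le> \<bar>R\<bar>" and [measurable]: "f \<in> borel_measurable borel" and f: "\<forall>y. norm (f y) \<le> 1"
    for R and f :: "'a \<Rightarrow> complex"
  proof (cases "R \<ge> 0")
    case True
    then show ?thesis using bound[of R f] that by simp
  next
    case False
    have "norm (\<integral>y. cis (R * (x \<bullet> y)) * f y \<partial>\<mu>2) = norm (\<integral>y. cis (- R * (x \<bullet> y)) * cnj (f y) \<partial>\<mu>2)" for x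
    proof -
      have "(\<integral>y. cis (- R * (x \<bullet> y)) * cnj (f y) \<partial>\<mu>2) = (\<integral>y. cnj (cis (R * (x \<bullet> y)) * f y) \<partial>\<mu>2)"
        by (simp add: cis_cnj cis_inverse)
      also have "\<dots> = cnj (\<integral>y. cis (R * (x \<bullet> y)) * f y \<partial>\<mu>2)" by (rule Bochner_Integration.integral_cnj)
      finally show ?thesis by (simp del: complex_cnj_mult)
    qed
    then show ?thesis using bound[of "-R" "\<lambda>y. cnj (f y)"] R f False by simp
  qed
  with A show ?thesis by blast
qed

text \<open>The assumptions on \<open>\<nu> i\<close> range over the whole index type because
  \<open>product_sigma_finite\<close> does; indices outside \<open>I\<close> can be given the zero
  measure.\<close>

locale frostman_pins =
  fixes \<nu> :: "'i \<Rightarrow> 'a::euclidean_space measure" and \<mu> :: "'a measure"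
    and C s M :: real and I :: "'i set"
  assumes pin_growth: "\<And>i. ball_growth (\<nu> i) C s"
    and pin_bounded: "\<And>i. AE x in \<nu> i. norm x \<le> M"
    and growth: "ball_growth \<mu> C s"
    and bounded: "AE x in \<mu>. norm x \<le> M"
    and I: "finite I" "I \<noteq> {}"
    and exponent: "real DIM('a) + real (card I) < 2 * s"
begin

sublocale base: ball_growth \<mu> C s by (rule growth)

lemma sets_pin [measurable_cong, simp]: "sets (\<nu> i) = sets borel"
  using pin_growth[of i] by (rule ball_growth.sets_eq)

lemma finite_pin: "finite_measure (\<nu> i)"
  using pin_growth[of i] by (rule ball_growth.axioms)

sublocale product_sigma_finite \<nu>
  by (rule product_sigma_finite.intro, rule finite_measure.axioms(1), rule finite_pin)

lemma finite_measure_pins: "finite J \<Longrightarrow> finite_measure (PiM J \<nu>)"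
proof
  assume "finite J"
  have "emeasure (PiM J \<nu>) (space (PiM J \<nu>)) = (\<Prod>i\<in>J. emeasure (\<nu> i) (space (\<nu> i)))"
    unfolding space_PiM by (rule emeasure_PiM[OF \<open>finite J\<close>]) (rule sets.top)
  also have "\<dots> \<noteq> \<infinity>"
    using finite_measure.emeasure_finite[OF finite_pin] \<open>finite J\<close>
    by (auto simp: ennreal_prod_eq_top)
  finally show "emeasure (PiM J \<nu>) (space (PiM J \<nu>)) \<noteq> \<infinity>" .
qed

section \<open>Mean square decay of the Fourier transform of the distance vector\<close>

definition decay :: real where "decay = 2 * s - real DIM('a)"

lemma decay: "decay > real (card I)" "decay > 0" "real (card I) \<ge> 1"
proof -
  show *: "decay > real (card I)" using exponent by (simp add: decay_def)
  have "card I > 0" using I by (simp add: card_gt_0_iff)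
  then show "real (card I) \<ge> 1" by simp
  with * show "decay > 0" by linarith
qed

text \<open>The Fourier transform at \<open>\<xi>\<close> of the image of \<open>\<mu>\<close> under
  the squared distances to the pins \<open>x\<close>.\<close>

definition dist_char :: "('i \<Rightarrow> real) \<Rightarrow> ('i \<Rightarrow> 'a) \<Rightarrow> complex" where
  "dist_char \<xi> x = (\<integral>y. cis (\<Sum>i\<in>I. \<xi> i * (norm (y - x i))\<^sup>2) \<partial>\<mu>)"

lemma dist_char_measurable [measurable]: "dist_char \<xi> \<in> borel_measurable (PiM I \<nu>)"
  unfolding dist_char_def by measurable

lemma norm_dist_char: "norm (dist_char \<xi> x) \<le> measure \<mu> (space \<mu>)"
  unfolding dist_char_def using base.norm_integral_bounded[of "\<lambda>y. cis (\<Sum>i\<in>I. \<xi> i * (norm (y - x i))\<^sup>2)" 1]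
  by simp

text \<open>The bound holds for every coordinate \<open>j\<close>, so the best one can be picked
  later for each \<open>\<xi>\<close>. The \<open>max\<close> joins two regimes: the total mass
  bound for small \<open>\<xi> j\<close> and the oscillatory bound in the pin \<open>x j\<close>,
  with the other pins frozen, for large \<open>\<xi> j\<close>.\<close>

lemma dist_char_decay:
  "\<exists>A\<ge>0. \<forall>\<xi>. \<forall>j\<in>I. (\<integral>\<^sup>+x. ennreal ((norm (dist_char \<xi> x))\<^sup>2) \<partial>PiM I \<nu>)
     \<le> ennreal (A * (max 1 \<bar>\<xi> j\<bar>) powr (- decay))"
proof -
  define m where "m = measure \<mu> (space \<mu>)"
  define T where "T J = measure (PiM J \<nu>) (space (PiM J \<nu>))" for J
  have ET: "emeasure (PiM J \<nu>) (space (PiM J \<nu>)) = ennreal (T J)" if "finite J" for J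
    unfolding T_def using finite_measure.emeasure_eq_measure[OF finite_measure_pins[OF that]] .
  have "\<exists>A\<ge>0. \<forall>R f. 1 \<le> \<bar>R\<bar> \<longrightarrow> f \<in> borel_measurable borel \<longrightarrow> (\<forall>y. norm (f y) \<le> 1) \<longrightarrow>
    (\<integral>\<^sup>+x. ennreal ((norm (\<integral>y. cis (R * (x \<bullet> y)) * f y \<partial>\<mu>))\<^sup>2) \<partial>\<nu> j)
      \<le> ennreal (A * \<bar>R\<bar> powr (real DIM('a) - 2 * s))" for j
    by (rule oscillatory_L2_bound_signed[OF pin_growth growth pin_bounded bounded])
  then have "\<exists>A. \<forall>j. 0 \<le> A j \<and> (\<forall>R f. 1 \<le> \<bar>R\<bar> \<longrightarrow> f \<in> borel_measurable borel \<longrightarrow> (\<forall>y. norm (f y) \<le> 1) \<longrightarrow>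
    (\<integral>\<^sup>+x. ennreal ((norm (\<integral>y. cis (R * (x \<bullet> y)) * f y \<partial>\<mu>))\<^sup>2) \<partial>\<nu> j)
      \<le> ennreal (A j * \<bar>R\<bar> powr (real DIM('a) - 2 * s)))"
    by (intro choice allI)
  then obtain A where A: "\<And>j. A j \<ge> 0" and osc: "\<And>j R f. 1 \<le> \<bar>R\<bar> \<Longrightarrow> f \<in> borel_measurable borel \<Longrightarrow> (\<And>y. norm (f y) \<le> 1) \<Longrightarrow>
    (\<integral>\<^sup>+x. ennreal ((norm (\<integral>y. cis (R * (x \<bullet> y)) * f y \<partial>\<mu>))\<^sup>2) \<partial>\<nu> j)
      \<le> ennreal (A j * \<bar>R\<bar> powr (real DIM('a) - 2 * s))"
    by blast
  define A' where "A' = m\<^sup>2 * T I + (\<Sum>j\<in>I. A j * T (I - {j}))"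
  have T0: "T J \<ge> 0" for J by (simp add: T_def)
  have A'1: "m\<^sup>2 * T I \<le> A'" unfolding A'_def using A T0 by (auto intro!: sum_nonneg)
  have A'2: "A j * T (I - {j}) \<le> A'" if "j \<in> I" for j
  proof -
    have "A j * T (I - {j}) \<le> (\<Sum>j\<in>I. A j * T (I - {j}))"
      using that I A T0 by (intro member_le_sum) auto
    also have "\<dots> \<le> A'" unfolding A'_def using T0 by simp
    finally show ?thesis .
  qed
  have "(\<integral>\<^sup>+x. ennreal ((norm (dist_char \<xi> x))\<^sup>2) \<partial>PiM I \<nu>)
     \<le> ennreal (A' * (max 1 \<bar>\<xi> j\<bar>) powr (- decay))" if j: "j \<in> I" for \<xi> j
  proof (cases "\<bar>\<xi> j\<bar> \<le> 1")
    case True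
    have "(\<integral>\<^sup>+x. ennreal ((norm (dist_char \<xi> x))\<^sup>2) \<partial>PiM I \<nu>) \<le> (\<integral>\<^sup>+x. ennreal (m\<^sup>2) \<partial>PiM I \<nu>)"
      unfolding m_def by (intro nn_integral_mono ennreal_leI power_mono norm_dist_char) auto
    also have "\<dots> = ennreal (m\<^sup>2 * T I)" using T0 by (simp add: ET I ennreal_mult)
    also have "\<dots> \<le> ennreal (A' * (max 1 \<bar>\<xi> j\<bar>) powr (- decay))"
      using True A'1 by (intro ennreal_leI) (simp add: max_def)
    finally show ?thesis .
  next
    case False
    define J where "J = I - {j}"
    have J: "finite J" "j \<notin> J" "I = insert j J" using I j by (auto simp: J_def)
    define D where "D = A j * \<bar>\<xi> j\<bar> powr (- decay)"
    have D: "D \<ge> 0" using A by (simp add: D_def)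
    have "(\<integral>\<^sup>+x. ennreal ((norm (dist_char \<xi> x))\<^sup>2) \<partial>PiM I \<nu>)
      = (\<integral>\<^sup>+x. (\<integral>\<^sup>+u. ennreal ((norm (dist_char \<xi> (x(j := u))))\<^sup>2) \<partial>\<nu> j) \<partial>PiM J \<nu>)"
      unfolding J(3) by (rule product_nn_integral_insert) (use J dist_char_measurable[of \<xi>] in \<open>auto simp: J(3)[symmetric]\<close>)
    also have "\<dots> \<le> (\<integral>\<^sup>+x. ennreal D \<partial>PiM J \<nu>)"
    proof (rule nn_integral_mono)
      fix x :: "'i \<Rightarrow> 'a"
      \<comment> \<open>The part of the phase free of \<open>u\<close>. The remaining term
        \<open>\<xi> j * (norm u)\<^sup>2\<close> is constant in \<open>y\<close> and vanishes in
        the modulus.\<close>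
      define f where "f y = cis (\<xi> j * (norm y)\<^sup>2 + (\<Sum>i\<in>J. \<xi> i * (norm (y - x i))\<^sup>2))" for y
      have [measurable]: "f \<in> borel_measurable borel" unfolding f_def by measurable
      have "norm (dist_char \<xi> (x(j := u))) = norm (\<integral>y. cis ((- 2 * \<xi> j) * (u \<bullet> y)) * f y \<partial>\<mu>)" for u
      proof -
        have "cis (\<Sum>i\<in>I. \<xi> i * (norm (y - (x(j := u)) i))\<^sup>2)
          = cis (\<xi> j * (norm u)\<^sup>2) * (cis ((- 2 * \<xi> j) * (u \<bullet> y)) * f y)" for y
        proof -
          have "(\<Sum>i\<in>I. \<xi> i * (norm (y - (x(j := u)) i))\<^sup>2) = \<xi> j * (norm (y - u))\<^sup>2 + (\<Sum>i\<in>J. \<xi> i * (norm (y - x i))\<^sup>2)"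
            using J by (auto intro!: sum.cong)
          also have "(norm (y - u))\<^sup>2 = (norm u)\<^sup>2 - 2 * (u \<bullet> y) + (norm y)\<^sup>2"
            by (simp add: power2_norm_eq_inner inner_diff inner_commute algebra_simps)
          finally have eq: "(\<Sum>i\<in>I. \<xi> i * (norm (y - (x(j := u)) i))\<^sup>2) = \<xi> j * (norm u)\<^sup>2 +
             (- 2 * \<xi> j * (u \<bullet> y) + (\<xi> j * (norm y)\<^sup>2 + (\<Sum>i\<in>J. \<xi> i * (norm (y - x i))\<^sup>2)))"
            by (simp add: algebra_simps)
          show ?thesis unfolding eq f_def cis_mult ..
        qed
        then show ?thesis by (simp add: dist_char_def norm_mult)
      qed
      then have "(\<integral>\<^sup>+u. ennreal ((norm (dist_char \<xi> (x(j := u))))\<^sup>2) \<partial>\<nu> j)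
        \<le> ennreal (A j * \<bar>- 2 * \<xi> j\<bar> powr (real DIM('a) - 2 * s))"
        using False osc[of "- 2 * \<xi> j" f j] by (simp add: f_def)
      \<comment> \<open>The exponent is \<open>- decay < 0\<close>, so the factor 2 in the frequency
        only helps.\<close>
      also have "\<dots> \<le> ennreal D"
        unfolding D_def using False decay(2) A
        by (intro ennreal_leI mult_left_mono) (auto simp: decay_def intro!: powr_mono2')
      finally show "(\<integral>\<^sup>+u. ennreal ((norm (dist_char \<xi> (x(j := u))))\<^sup>2) \<partial>\<nu> j) \<le> ennreal D" .
    qed
    also have "\<dots> = ennreal (D * T J)"
      using T0 D by (simp add: ET J ennreal_mult)
    also have "\<dots> \<le> ennreal (A' * (max 1 \<bar>\<xi> j\<bar>) powr (- decay))"
      using mult_right_mono[OF A'2[OF j], of "\<bar>\<xi> j\<bar> powr (- decay)"] False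
      by (intro ennreal_leI) (simp add: D_def J_def max_def mult_ac)
    finally show ?thesis .
  qed
  moreover have "A' \<ge> 0" using A'1 T0 by (meson mult_nonneg_nonneg order_trans zero_le_power2)
  ultimately show ?thesis by blast
qed

text \<open>For \<open>\<sigma> > 0\<close>, up to a constant,
  \<open>\<sigma> ^ card I * energy \<sigma> x\<close> is the squared L2 norm of the image measure
  mollified by a Gaussian of width of order \<open>1 / \<sigma>\<close>.\<close>

definition energy :: "real \<Rightarrow> ('i \<Rightarrow> 'a) \<Rightarrow> ennreal" where
  "energy \<sigma> x = (\<integral>\<^sup>+y. (\<integral>\<^sup>+y'. ennreal
     (\<Prod>i\<in>I. exp (- (\<sigma> * ((norm (y - x i))\<^sup>2 - (norm (y' - x i))\<^sup>2))\<^sup>2 / 2)) \<partial>\<mu>) \<partial>\<mu>)"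

lemma energy_measurable [measurable]: "energy \<sigma> \<in> borel_measurable (PiM I \<nu>)"
  unfolding energy_def by measurable

text \<open>The kernel is the characteristic function of independent centred normal variables of
  deviation \<open>\<sigma>\<close>. By Fubini the mean energy is therefore the mean of the integral
  of \<open>(norm (dist_char \<xi> x))\<^sup>2\<close> over Gaussian random \<open>\<xi>\<close>, to
  which \<open>dist_char_decay\<close> applies.\<close>

lemma energy_average:
  "\<exists>A\<ge>0. \<forall>\<sigma>>0. (\<integral>\<^sup>+x. energy \<sigma> x \<partial>PiM I \<nu>) \<le> ennreal (A / \<sigma> ^ card I)"
proof -
  define k where "k = card I"
  define a where "a = decay / real k"
  have k: "real k \<ge> 1" using decay(3) by (simp add: k_def)
  have a: "a > 1" "a * real k = decay" using decay(1) k by (auto simp: a_def k_def field_simps)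
  obtain A where A: "A \<ge> 0" and dc: "\<And>\<xi> j. j \<in> I \<Longrightarrow> (\<integral>\<^sup>+x. ennreal ((norm (dist_char \<xi> x))\<^sup>2) \<partial>PiM I \<nu>)
     \<le> ennreal (A * (max 1 \<bar>\<xi> j\<bar>) powr (- decay))"
    using dist_char_decay by blast
  define w where "w t = max 1 \<bar>t\<bar> powr (- a)" for t :: real
  have w0: "w t > 0" for t by (simp add: w_def)
  have [measurable]: "w \<in> borel_measurable borel" unfolding w_def by measurable
  \<comment> \<open>With \<open>j\<close> the largest frequency, the decay is shared evenly among
    the \<open>k\<close> coordinates. Each share is at most \<open>w (\<xi> i)\<close>, since
    \<open>w\<close> decreases in the modulus. A bound in the maximum becomes a product, integrable
    in each coordinate because \<open>a > 1\<close>.\<close>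
  have dc': "(\<integral>\<^sup>+x. ennreal ((norm (dist_char \<xi> x))\<^sup>2) \<partial>PiM I \<nu>) \<le> ennreal A * (\<Prod>i\<in>I. ennreal (w (\<xi> i)))" for \<xi>
  proof -
    obtain j where j: "j \<in> I" and jmax: "\<And>i. i \<in> I \<Longrightarrow> \<bar>\<xi> i\<bar> \<le> \<bar>\<xi> j\<bar>"
      by (rule obtains_MAX[OF I, of "\<lambda>i. \<bar>\<xi> i\<bar>"]) (metis I(1) Max_ge finite_imageI imageI)
    have "(max 1 \<bar>\<xi> j\<bar>) powr (- decay) = (w (\<xi> j)) ^ k"
    proof -
      have "(w (\<xi> j)) ^ k = (w (\<xi> j)) powr (real k)"
        using w0 by (simp add: powr_realpow)
      then show ?thesis using a(2) by (simp add: w_def powr_powr)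
    qed
    also have "\<dots> = (\<Prod>i\<in>I. w (\<xi> j))" by (simp add: k_def)
    also have "\<dots> \<le> (\<Prod>i\<in>I. w (\<xi> i))"
      using jmax a unfolding w_def by (intro prod_mono conjI powr_mono2' max.mono) auto
    finally have "A * (max 1 \<bar>\<xi> j\<bar>) powr (- decay) \<le> A * (\<Prod>i\<in>I. w (\<xi> i))"
      using A by (intro mult_left_mono)
    then have "ennreal (A * (max 1 \<bar>\<xi> j\<bar>) powr (- decay)) \<le> ennreal (A * (\<Prod>i\<in>I. w (\<xi> i)))"
      by (rule ennreal_leI)
    also have "\<dots> = ennreal A * (\<Prod>i\<in>I. ennreal (w (\<xi> i)))"
      using A w0 by (simp add: ennreal_mult prod_nonneg less_imp_le prod_ennreal)
    finally show ?thesis using dc[OF j, of \<xi>] by simp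
  qed
  define V where "V = enn2real (\<integral>\<^sup>+t. ennreal (w t) \<partial>lborel)"
  have V: "(\<integral>\<^sup>+t. ennreal (w t) \<partial>lborel) = ennreal V" "V \<ge> 0"
    using nn_integral_max_powr_finite[OF a(1)] by (simp_all add: V_def w_def)
  have main: "(\<integral>\<^sup>+x. energy \<sigma> x \<partial>PiM I \<nu>) \<le> ennreal (A * V ^ k / \<sigma> ^ card I)" if \<sigma>: "\<sigma> > 0" for \<sigma>
  proof -
    define \<gamma> where "\<gamma> = density lborel (\<lambda>u. ennreal (normal_density 0 \<sigma> u))"
    have [measurable_cong]: "sets \<gamma> = sets borel" by (simp add: \<gamma>_def)
    interpret \<gamma>: prob_space \<gamma> unfolding \<gamma>_def using \<sigma> by (rule prob_space_normal_density)
    interpret \<gamma>s: product_prob_space "\<lambda>_::'i. \<gamma>" ..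
    define \<Gamma> where "\<Gamma> = PiM I (\<lambda>_::'i. \<gamma>)"
    interpret \<Gamma>: prob_space \<Gamma> unfolding \<Gamma>_def by (rule prob_space_PiM) unfold_locales
    have [measurable_cong]: "sets \<Gamma> = sets (PiM I (\<lambda>_::'i. borel))"
      unfolding \<Gamma>_def by (intro sets_PiM_cong) (auto simp: \<gamma>_def)
    have char: "(\<integral>u. cis (u * b) \<partial>\<gamma>) = of_real (exp (- (\<sigma> * b)\<^sup>2 / 2))" for b
    proof -
      have "(\<integral>u. cis (u * b) \<partial>\<gamma>) = (\<integral>u. of_real (1 / (sqrt (2 * pi) * \<sigma>)) * (cis (u * b) * of_real (exp (- u\<^sup>2 / (2 * \<sigma>\<^sup>2)))) \<partial>lborel)"
        unfolding \<gamma>_def using \<sigma>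
        by (subst integral_density)
           (auto simp: normal_density_def scaleR_conv_of_real real_sqrt_mult mult_ac intro!: Bochner_Integration.integral_cong)
      also have "\<dots> = of_real (1 / (sqrt (2 * pi) * \<sigma>)) * (\<integral>u. cis (u * b) * of_real (exp (- u\<^sup>2 / (2 * \<sigma>\<^sup>2))) \<partial>lborel)"
        by (rule integral_mult_right_zero)
      also have "(\<integral>u. cis (u * b) * of_real (exp (- u\<^sup>2 / (2 * \<sigma>\<^sup>2))) \<partial>lborel) = of_real (sqrt (2 * pi) * \<sigma> * exp (- (\<sigma> * b)\<^sup>2 / 2))"
        using gaussian_fourier_real[OF \<sigma>, of b] by (simp add: has_bochner_integral_iff)
      finally show ?thesis using \<sigma> by simp
    qed
    have chars: "(\<integral>\<xi>. cis (\<Sum>i\<in>I. \<xi> i * b i) \<partial>\<Gamma>) = of_real (\<Prod>i\<in>I. exp (- (\<sigma> * b i)\<^sup>2 / 2))" for b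
    proof -
      have "(\<integral>\<xi>. (\<Prod>i\<in>I. cis (\<xi> i * b i)) \<partial>\<Gamma>) = (\<Prod>i\<in>I. (\<integral>u. cis (u * b i) \<partial>\<gamma>))"
        unfolding \<Gamma>_def by (rule \<gamma>s.product_integral_prod) (auto intro!: I \<gamma>.integrable_bounded[of _ 1])
      then show ?thesis by (simp add: cis_sum char)
    qed
    define N where "N = PiM I \<nu> \<Otimes>\<^sub>M (\<mu> \<Otimes>\<^sub>M \<mu>)"
    have [measurable_cong]: "sets N = sets (PiM I \<nu> \<Otimes>\<^sub>M (\<mu> \<Otimes>\<^sub>M \<mu>))" unfolding N_def by (rule refl)
    interpret nu: finite_measure "PiM I \<nu>" by (rule finite_measure_pins[OF I(1)])
    interpret PP: pair_sigma_finite \<mu> \<mu> ..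
    interpret PP: finite_measure "\<mu> \<Otimes>\<^sub>M \<mu>" by (rule finite_measure_pair_measure) unfold_locales
    interpret NP: pair_sigma_finite "PiM I \<nu>" "\<mu> \<Otimes>\<^sub>M \<mu>" ..
    interpret N: finite_measure N unfolding N_def by (rule finite_measure_pair_measure) unfold_locales
    define t where "t p i = (norm (fst (snd p) - fst p i))\<^sup>2 - (norm (snd (snd p) - fst p i))\<^sup>2"
      for p :: "('i \<Rightarrow> 'a) \<times> 'a \<times> 'a" and i
    have [measurable]: "(\<lambda>p. t p i) \<in> borel_measurable N" if "i \<in> I" for i
      unfolding t_def using that by measurable
    define F where "F p = (\<Prod>i\<in>I. exp (- (\<sigma> * t p i)\<^sup>2 / 2))" for p
    have [measurable]: "F \<in> borel_measurable N" unfolding F_def by measurable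
    have F01: "0 \<le> F p" "F p \<le> 1" for p unfolding F_def by (auto intro!: prod_nonneg prod_le_1)
    have F_int: "integrable N F" using F01 by (intro N.integrable_bounded[of _ 1]) auto
    have "(\<integral>\<^sup>+x. energy \<sigma> x \<partial>PiM I \<nu>) = (\<integral>\<^sup>+x. (\<integral>\<^sup>+y. (\<integral>\<^sup>+y'. ennreal (F (x, y, y')) \<partial>\<mu>) \<partial>\<mu>) \<partial>PiM I \<nu>)"
      by (simp add: energy_def F_def t_def)
    also have "\<dots> = (\<integral>\<^sup>+x. (\<integral>\<^sup>+q. ennreal (F (x, q)) \<partial>(\<mu> \<Otimes>\<^sub>M \<mu>)) \<partial>PiM I \<nu>)"
      by (intro nn_integral_cong base.nn_integral_fst) measurable
    also have "\<dots> = (\<integral>\<^sup>+p. ennreal (F p) \<partial>N)"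
      unfolding N_def by (rule PP.nn_integral_fst) measurable
    also have "\<dots> = ennreal (\<integral>p. F p \<partial>N)"
      by (rule nn_integral_eq_integral[OF F_int]) (simp add: F01)
    also have "\<dots> = ennreal (norm (\<integral>p. complex_of_real (F p) \<partial>N))"
      by (simp only: integral_complex_of_real norm_of_real) (simp add: F01 integral_nonneg)
    also have "(\<integral>p. complex_of_real (F p) \<partial>N) = (\<integral>p. (\<integral>\<xi>. cis (\<Sum>i\<in>I. \<xi> i * t p i) \<partial>\<Gamma>) \<partial>N)"
      by (simp only: chars F_def)
    also have "\<dots> = (\<integral>\<xi>. (\<integral>p. cis (\<Sum>i\<in>I. \<xi> i * t p i) \<partial>N) \<partial>\<Gamma>)"
      by (rule Fubini_dominated[symmetric, where g="\<lambda>_. 1"])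
         (auto intro: N.sigma_finite_measure_axioms \<Gamma>.finite_measure_axioms)
    also have "ennreal (norm \<dots>) \<le> (\<integral>\<^sup>+\<xi>. ennreal (norm (\<integral>p. cis (\<Sum>i\<in>I. \<xi> i * t p i) \<partial>N)) \<partial>\<Gamma>)"
      using N.norm_integral_bounded[of "\<lambda>p. cis (\<Sum>i\<in>I. _ i * t p i)" 1]
      by (intro integral_norm_bound_ennreal \<Gamma>.integrable_bounded[of _ "1 * measure N (space N)"]) auto
    also have "\<dots> = (\<integral>\<^sup>+\<xi>. (\<integral>\<^sup>+x. ennreal ((norm (dist_char \<xi> x))\<^sup>2) \<partial>PiM I \<nu>) \<partial>\<Gamma>)"
    proof (rule nn_integral_cong)
      fix \<xi> :: "'i \<Rightarrow> real"
      define c where "c x y = cis (\<Sum>i\<in>I. \<xi> i * (norm (y - x i))\<^sup>2)" for x and y :: 'a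
      \<comment> \<open>The phase is a difference of a function of \<open>y\<close> and the same
        function of \<open>y'\<close>, so the integral over pairs is \<open>dist_char\<close> times
        its conjugate.\<close>
      have c_mult: "cis (\<Sum>i\<in>I. \<xi> i * t (x, y, y') i) = c x y * cnj (c x y')" for x y y'
        by (simp add: c_def t_def cis_cnj cis_inverse cis_mult right_diff_distrib sum_subtractf)
      have [measurable]: "c x \<in> borel_measurable borel" for x unfolding c_def by measurable
      have "(\<integral>p. cis (\<Sum>i\<in>I. \<xi> i * t p i) \<partial>N) = (\<integral>x. (\<integral>q. cis (\<Sum>i\<in>I. \<xi> i * t (x, q) i) \<partial>(\<mu> \<Otimes>\<^sub>M \<mu>)) \<partial>PiM I \<nu>)"
        unfolding N_def by (rule NP.integral_fst'[symmetric]) (auto simp: N_def[symmetric] intro!: N.integrable_bounded[of _ 1])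
      also have "\<dots> = (\<integral>x. complex_of_real ((norm (dist_char \<xi> x))\<^sup>2) \<partial>PiM I \<nu>)"
      proof (rule Bochner_Integration.integral_cong[OF refl])
        fix x
        have "(\<integral>q. cis (\<Sum>i\<in>I. \<xi> i * t (x, q) i) \<partial>(\<mu> \<Otimes>\<^sub>M \<mu>)) = (\<integral>q. c x (fst q) * cnj (c x (snd q)) \<partial>(\<mu> \<Otimes>\<^sub>M \<mu>))"
          by (intro Bochner_Integration.integral_cong[OF refl]) (metis c_mult prod.collapse)
        also have "\<dots> = (\<integral>y. (\<integral>y'. c x y * cnj (c x y') \<partial>\<mu>) \<partial>\<mu>)"
          by (subst PP.integral_fst'[symmetric]) (auto simp: c_def norm_mult intro!: PP.integrable_bounded[of _ 1])
        also have "\<dots> = dist_char \<xi> x * cnj (dist_char \<xi> x)"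
          by (simp add: dist_char_def c_def)
        finally show "(\<integral>q. cis (\<Sum>i\<in>I. \<xi> i * t (x, q) i) \<partial>(\<mu> \<Otimes>\<^sub>M \<mu>)) = complex_of_real ((norm (dist_char \<xi> x))\<^sup>2)"
          by (simp only: complex_norm_square)
      qed
      also have "\<dots> = complex_of_real (\<integral>x. (norm (dist_char \<xi> x))\<^sup>2 \<partial>PiM I \<nu>)"
        by (rule integral_complex_of_real)
      finally have "ennreal (norm (\<integral>p. cis (\<Sum>i\<in>I. \<xi> i * t p i) \<partial>N)) = ennreal (\<integral>x. (norm (dist_char \<xi> x))\<^sup>2 \<partial>PiM I \<nu>)"
        by simp
      also have "\<dots> = (\<integral>\<^sup>+x. ennreal ((norm (dist_char \<xi> x))\<^sup>2) \<partial>PiM I \<nu>)"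
        using norm_dist_char
        by (intro nn_integral_eq_integral[symmetric] nu.integrable_bounded[of _ "(measure \<mu> (space \<mu>))\<^sup>2"])
           (auto intro!: power_mono)
      finally show "ennreal (norm (\<integral>p. cis (\<Sum>i\<in>I. \<xi> i * t p i) \<partial>N)) = \<dots>" .
    qed
    also have "\<dots> \<le> (\<integral>\<^sup>+\<xi>. ennreal A * (\<Prod>i\<in>I. ennreal (w (\<xi> i))) \<partial>\<Gamma>)"
      by (intro nn_integral_mono dc')
    also have "\<dots> = ennreal A * (\<integral>\<^sup>+\<xi>. (\<Prod>i\<in>I. ennreal (w (\<xi> i))) \<partial>\<Gamma>)"
      by (rule nn_integral_cmult) measurable
    also have "(\<integral>\<^sup>+\<xi>. (\<Prod>i\<in>I. ennreal (w (\<xi> i))) \<partial>\<Gamma>) = (\<Prod>i\<in>I. (\<integral>\<^sup>+u. ennreal (w u) \<partial>\<gamma>))"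
      unfolding \<Gamma>_def by (rule \<gamma>s.product_nn_integral_prod) (auto intro!: I)
    \<comment> \<open>Bounding the normal density by \<open>1 / \<sigma>\<close> costs nothing in
      the order and supplies one factor \<open>1 / \<sigma>\<close> per coordinate.\<close>
    also have "\<dots> \<le> (\<Prod>i\<in>I. ennreal (V / \<sigma>))"
    proof (simp only: prod_constant, intro power_mono)
      have "(\<integral>\<^sup>+u. ennreal (w u) \<partial>\<gamma>) = (\<integral>\<^sup>+u. ennreal (normal_density 0 \<sigma> u) * ennreal (w u) \<partial>lborel)"
        unfolding \<gamma>_def by (rule nn_integral_density) auto
      also have "\<dots> \<le> (\<integral>\<^sup>+u. ennreal (1 / \<sigma>) * ennreal (w u) \<partial>lborel)"
      proof (intro nn_integral_mono mult_right_mono ennreal_leI)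
        fix u
        have "exp (- u\<^sup>2 / (2 * \<sigma>\<^sup>2)) / sqrt (2 * pi) \<le> 1 / 1"
          using pi_ge_two by (intro frac_le) (auto simp: real_le_rsqrt)
        then show "normal_density 0 \<sigma> u \<le> 1 / \<sigma>"
          using \<sigma> by (simp add: normal_density_def real_sqrt_mult field_simps)
      qed auto
      also have "\<dots> = ennreal (1 / \<sigma>) * ennreal V" by (subst nn_integral_cmult) (auto simp: V)
      also have "\<dots> = ennreal (V / \<sigma>)" using \<sigma> V by (simp flip: ennreal_mult)
      finally show "(\<integral>\<^sup>+u. ennreal (w u) \<partial>\<gamma>) \<le> ennreal (V / \<sigma>)" .
    qed auto
    also have "\<dots> = ennreal ((V / \<sigma>) ^ k)" using V \<sigma> by (simp add: k_def ennreal_power)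
    also have "ennreal A * \<dots> = ennreal (A * V ^ k / \<sigma> ^ card I)"
      using A V \<sigma> by (simp add: power_divide k_def flip: ennreal_mult)
    finally show ?thesis by (simp add: mult_left_mono)
  qed
  then show ?thesis using A V by (intro exI[of _ "A * V ^ k"]) auto
qed

text \<open>The scaled energies have means bounded independently of \<open>n\<close>, so by Fatou's
  lemma their liminf is integrable.\<close>

lemma AE_liminf_energy_finite:
  "AE x in PiM I \<nu>. liminf (\<lambda>n. ennreal (real n ^ card I) * energy (real n) x) \<noteq> \<infinity>"
proof -
  obtain A where A: "A \<ge> 0" "\<And>\<sigma>. \<sigma> > 0 \<Longrightarrow> (\<integral>\<^sup>+x. energy \<sigma> x \<partial>PiM I \<nu>) \<le> ennreal (A / \<sigma> ^ card I)"
    using energy_average by blast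
  have "(\<integral>\<^sup>+x. liminf (\<lambda>n. ennreal (real n ^ card I) * energy (real n) x) \<partial>PiM I \<nu>)
    \<le> liminf (\<lambda>n. \<integral>\<^sup>+x. ennreal (real n ^ card I) * energy (real n) x \<partial>PiM I \<nu>)"
    by (rule nn_integral_liminf) measurable
  also have "\<dots> \<le> liminf (\<lambda>n. ennreal A)"
  proof (rule Liminf_mono)
    show "\<forall>\<^sub>F n in sequentially. (\<integral>\<^sup>+x. ennreal (real n ^ card I) * energy (real n) x \<partial>PiM I \<nu>) \<le> ennreal A"
      using eventually_gt_at_top[of 0]
    proof eventually_elim
      fix n :: nat assume n: "n > 0"
      have "(\<integral>\<^sup>+x. ennreal (real n ^ card I) * energy (real n) x \<partial>PiM I \<nu>)
        = ennreal (real n ^ card I) * (\<integral>\<^sup>+x. energy (real n) x \<partial>PiM I \<nu>)"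
        by (rule nn_integral_cmult) measurable
      also have "\<dots> \<le> ennreal (real n ^ card I) * ennreal (A / real n ^ card I)"
        using n by (intro mult_left_mono A(2)) auto
      also have "\<dots> = ennreal A" using n A(1) by (simp flip: ennreal_mult)
      finally show "(\<integral>\<^sup>+x. ennreal (real n ^ card I) * energy (real n) x \<partial>PiM I \<nu>) \<le> ennreal A" .
    qed
  qed
  also have "\<dots> = ennreal A" by (simp add: Liminf_const)
  finally have "(\<integral>\<^sup>+x. liminf (\<lambda>n. ennreal (real n ^ card I) * energy (real n) x) \<partial>PiM I \<nu>) \<noteq> \<infinity>"
    using ennreal_less_top[of A] by (metis infinity_ennreal_def not_le)
  then show ?thesis
    by (intro nn_integral_noteq_infinite) measurable
qed

end

section \<open>From distances to areas\<close>

text \<open>Tonelli for the indicator of the exceptional set; it allows almost-everywhere statements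
  on a finite product to be proved one coordinate at a time.\<close>

lemma (in product_sigma_finite) AE_PiM_insert_iff:
  assumes I: "finite I" "i \<notin> I"
    and P [measurable]: "Measurable.pred (PiM (insert i I) M) P"
  shows "(AE x in PiM (insert i I) M. P x) \<longleftrightarrow> (AE x in PiM I M. AE u in M i. P (x(i := u)))"
proof -
  interpret Mi: sigma_finite_measure "M i" by (rule sigma_finite_measures)
  let ?f = "\<lambda>x. indicator {x. \<not> P x} x :: ennreal"
  have f [measurable]: "?f \<in> borel_measurable (PiM (insert i I) M)" by measurable
  have "(AE x in PiM (insert i I) M. P x) \<longleftrightarrow> (\<integral>\<^sup>+x. ?f x \<partial>PiM (insert i I) M) = 0"
    by (subst nn_integral_0_iff_AE) (auto simp: indicator_def)
  also have "\<dots> \<longleftrightarrow> (\<integral>\<^sup>+x. (\<integral>\<^sup>+u. ?f (x(i := u)) \<partial>M i) \<partial>PiM I M) = 0"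
    by (subst product_nn_integral_insert[OF I f]) rule
  also have "\<dots> \<longleftrightarrow> (AE x in PiM I M. (\<integral>\<^sup>+u. ?f (x(i := u)) \<partial>M i) = 0)"
    by (rule nn_integral_0_iff_AE) measurable
  also have "\<dots> \<longleftrightarrow> (AE x in PiM I M. AE u in M i. P (x(i := u)))"
  proof (rule AE_cong)
    fix x assume [measurable]: "x \<in> space (PiM I M)"
    show "(\<integral>\<^sup>+u. ?f (x(i := u)) \<partial>M i) = 0 \<longleftrightarrow> (AE u in M i. P (x(i := u)))"
      by (subst nn_integral_0_iff_AE) (auto simp: indicator_def)
  qed
  finally show ?thesis .
qed

text \<open>Away from the vertex \<open>v = e\<close> the map has four differentiable inverse
  branches, one for each side of the vertex and each sign of the radicand. Differentiable maps send
  null sets to null sets, so the preimage of a null set is null.\<close>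

lemma AE_lborel_parabola:
  fixes P :: "real \<Rightarrow> bool"
  assumes P: "AE a in lborel. P a"
  shows "AE v in lborel. P (sqrt (b - (v - e)\<^sup>2 / 4) / 2)"
proof -
  obtain N where N: "N \<in> null_sets lborel" "{a. \<not> P a} \<subseteq> N"
    using P unfolding eventually_ae_filter by auto
  then have neg: "negligible N"
    by (auto simp: negligible_iff_null_sets intro: null_sets_completionI)
  \<comment> \<open>Where the radicand of the inverse branch is positive, hence the branch
    differentiable. The sign \<open>\<tau>\<close> accounts for \<open>sqrt\<close> being odd, the
    sign \<open>\<sigma>\<close> for the side of the vertex.\<close>
  define T where "T \<tau> = {a. b - \<tau> * 4 * a\<^sup>2 > 0}" for \<tau> :: real
  define f where "f \<sigma> \<tau> a = e + \<sigma> * (2 * sqrt (b - \<tau> * 4 * a\<^sup>2))" for \<sigma> \<tau> a :: real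
  have "negligible (f \<sigma> \<tau> ` (N \<inter> T \<tau>))" for \<sigma> \<tau>
  proof (rule negligible_differentiable_image_negligible)
    show "negligible (N \<inter> T \<tau>)" by (rule negligible_subset[OF neg]) simp
    show "f \<sigma> \<tau> differentiable_on N \<inter> T \<tau>"
      unfolding f_def
      by (intro differentiable_at_imp_differentiable_on)
         (auto simp: T_def real_differentiable_def intro!: exI derivative_eq_intros)
  qed simp
  then have "negligible ({e} \<union> (\<Union>\<sigma>\<in>{-1,1}. \<Union>\<tau>\<in>{-1,1}. f \<sigma> \<tau> ` (N \<inter> T \<tau>)))"
    by (intro negligible_Un negligible_Union) auto
  then have "AE v in lebesgue. v \<notin> {e} \<union> (\<Union>\<sigma>\<in>{-1,1}. \<Union>\<tau>\<in>{-1,1}. f \<sigma> \<tau> ` (N \<inter> T \<tau>))"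
    unfolding negligible_iff_null_sets by (rule AE_not_in)
  then have "AE v in lebesgue. P (sqrt (b - (v - e)\<^sup>2 / 4) / 2)"
  proof eventually_elim
    fix v assume v: "v \<notin> {e} \<union> (\<Union>\<sigma>\<in>{-1,1}. \<Union>\<tau>\<in>{-1,1}. f \<sigma> \<tau> ` (N \<inter> T \<tau>))"
    define a where "a = sqrt (b - (v - e)\<^sup>2 / 4) / 2"
    define \<tau> :: real where "\<tau> = (if b - (v - e)\<^sup>2 / 4 \<ge> 0 then 1 else -1)"
    define \<sigma> :: real where "\<sigma> = (if v \<ge> e then 1 else -1)"
    have "\<tau> * 4 * a\<^sup>2 = b - (v - e)\<^sup>2 / 4"
    proof (cases "b - (v - e)\<^sup>2 / 4 \<ge> 0")
      case True
      then show ?thesis by (simp add: a_def \<tau>_def power_divide)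
    next
      case False
      then have "sqrt (b - (v - e)\<^sup>2 / 4) = - sqrt ((v - e)\<^sup>2 / 4 - b)"
        by (simp flip: real_sqrt_minus)
      with False show ?thesis by (simp add: a_def \<tau>_def power_divide)
    qed
    then have eq: "b - \<tau> * 4 * a\<^sup>2 = ((v - e) / 2)\<^sup>2" by (simp add: power_divide)
    have "v \<noteq> e" using v by auto
    then have "b - \<tau> * 4 * a\<^sup>2 > 0" unfolding eq by simp
    then have "a \<in> T \<tau>" by (simp add: T_def)
    moreover have "f \<sigma> \<tau> a = v" unfolding f_def eq by (simp add: \<sigma>_def)
    moreover have "\<sigma> \<in> {-1, 1}" "\<tau> \<in> {-1, 1}" by (auto simp: \<sigma>_def \<tau>_def)
    ultimately have "a \<notin> N" using v by fastforce
    then show "P (sqrt (b - (v - e)\<^sup>2 / 4) / 2)" using N(2) by (auto simp: a_def)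
  qed
  then show ?thesis by (simp only: AE_completion_iff)
qed

text \<open>
  The arguments are squared side lengths. Where they violate the triangle inequality the radicand
  is negative, and \<^const>\<open>sqrt\<close> continues as an odd function.
\<close>

definition heron :: "real \<Rightarrow> real \<Rightarrow> real \<Rightarrow> real" where
  "heron l c v = sqrt (l * c - (l + c - v)\<^sup>2 / 4) / 2"

text \<open>By the law of cosines \<open>(l + c - v) / 2\<close> is the inner product of two edge
  vectors, so the radicand is their Gram determinant.\<close>

lemma triangle_area_eq_heron:
  "triangle_area x y z = heron ((norm (y - x))\<^sup>2) ((norm (z - x))\<^sup>2) ((norm (z - y))\<^sup>2)"
proof -
  have "(norm (z - y))\<^sup>2 = (norm (z - x))\<^sup>2 + (norm (y - x))\<^sup>2 - 2 * ((y - x) \<bullet> (z - x))"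
    by (simp add: power2_norm_eq_inner inner_diff inner_commute algebra_simps)
  then have *: "(y - x) \<bullet> (z - x) = ((norm (y - x))\<^sup>2 + (norm (z - x))\<^sup>2 - (norm (z - y))\<^sup>2) / 2" by simp
  then show ?thesis unfolding triangle_area_eq_gram heron_def * by (simp add: power_divide)
qed

text \<open>With \<open>l i\<close> the squared distance between consecutive pins and
  \<open>D i\<close> the squared distance from \<open>y\<close> to pin \<open>i\<close>, this is the
  area vector of \<open>y\<close>. The length \<open>m\<close> is a parameter for the sake of
  induction.\<close>

definition heron_chain :: "(nat \<Rightarrow> real) \<Rightarrow> nat \<Rightarrow> (nat \<Rightarrow> real) \<Rightarrow> nat \<Rightarrow> real" where
  "heron_chain l m D = (\<lambda>i\<in>{1..<m}. heron (l i) (D i) (D (i + 1)))"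

lemma heron_chain_measurable [measurable]:
  "heron_chain l m \<in> measurable (PiM {1..m} (\<lambda>_. lborel)) (PiM {1..<m} (\<lambda>_. lborel))"
  unfolding heron_chain_def heron_def
proof (rule measurable_restrict)
  fix i assume "i \<in> {1..<m}"
  then have "i \<in> {1..m}" "i + 1 \<in> {1..m}" by auto
  then have [measurable]: "(\<lambda>D. D i) \<in> borel_measurable (PiM {1..m} (\<lambda>_. lborel :: real measure))"
    "(\<lambda>D. D (i + 1)) \<in> borel_measurable (PiM {1..m} (\<lambda>_. lborel :: real measure))"
    using measurable_component_singleton[where M="\<lambda>_. lborel :: real measure"] by auto
  show "(\<lambda>D. sqrt (l i * D i - (l i + D i - D (i + 1))\<^sup>2 / 4) / 2) \<in> measurable (PiM {1..m} (\<lambda>_. lborel)) lborel"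
    by measurable
qed

text \<open>
  The map is triangular: with \<open>D 1, \<dots>, D i\<close> fixed, the \<open>i\<close>-th entry depends on \<open>D (i + 1)\<close>
  only, through a map that pulls null sets back to null sets.
\<close>

lemma AE_heron_chain:
  assumes "m \<ge> 1" "S \<in> null_sets (PiM {1..<m} (\<lambda>_. lborel))"
  shows "AE D in PiM {1..m} (\<lambda>_. lborel). heron_chain l m D \<notin> S"
  using assms
proof (induction m arbitrary: S rule: dec_induct)
  case base
  \<comment> \<open>The product over no coordinates is a single point of mass 1, so its only null
    set is empty.\<close>
  have "S \<subseteq> {\<lambda>_. undefined}"
    using null_setsD2[OF base] sets.sets_into_space[of S "PiM {1..<1::nat} (\<lambda>_. lborel :: real measure)"]
    by (auto simp: space_PiM)
  moreover have "S \<noteq> {\<lambda>_. undefined}"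
    using null_setsD1[OF base] by auto
  ultimately have "S = {}" by blast
  then show ?case by simp
next
  case (step m)
  interpret product_sigma_finite "\<lambda>_::nat. lborel :: real measure" ..
  have m: "m \<ge> 1" using step by simp
  have I1: "{1..<Suc m} = insert m {1..<m}" and I2: "{1..Suc m} = insert (Suc m) {1..m}"
    using m by auto
  have S: "S \<in> null_sets (PiM (insert m {1..<m}) (\<lambda>_. lborel))"
    using step.prems by (simp only: I1)
  have [measurable]: "S \<in> sets (PiM (insert m {1..<m}) (\<lambda>_. lborel))" using S by blast
  have [measurable]: "S \<in> sets (PiM {1..<Suc m} (\<lambda>_. lborel))" using step.prems by blast
  have pred: "Measurable.pred (PiM (insert m {1..<m}) (\<lambda>_. lborel)) (\<lambda>x. x \<notin> S)" by measurable
  have "AE a in PiM {1..<m} (\<lambda>_. lborel). AE u in lborel. a(m := u) \<notin> S"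
    by (rule AE_PiM_insert_iff[THEN iffD1, OF _ _ pred AE_not_in[OF S]]) auto
  \<comment> \<open>\<open>N\<close> collects the points over which the section of \<open>S\<close>
    is not null. The induction hypothesis is applied to \<open>N\<close> and the parabola lemma to
    the sections.\<close>
  then obtain N where N: "{a \<in> space (PiM {1..<m} (\<lambda>_. lborel)). \<not> (AE u in lborel. a(m := u) \<notin> S)} \<subseteq> N"
    "N \<in> null_sets (PiM {1..<m} (\<lambda>_. lborel))"
    unfolding eventually_ae_filter by blast
  have AE_D: "AE D in PiM {1..m} (\<lambda>_. lborel). AE v in lborel. heron_chain l (Suc m) (D(Suc m := v)) \<notin> S"
    using step.IH[OF N(2)] AE_space
  proof eventually_elim
    fix D assume D: "heron_chain l m D \<notin> N" "D \<in> space (PiM {1..m} (\<lambda>_. lborel :: real measure))"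
    have "heron_chain l m D \<in> space (PiM {1..<m} (\<lambda>_. lborel))"
      using measurable_space[OF heron_chain_measurable D(2)] .
    with D N(1) have "AE u in lborel. (heron_chain l m D)(m := u) \<notin> S" by blast
    from AE_lborel_parabola[OF this, of "l m * D m" "l m + D m"]
    show "AE v in lborel. heron_chain l (Suc m) (D(Suc m := v)) \<notin> S"
    proof (rule AE_mp, intro AE_I2 impI)
      fix v
      have "heron_chain l (Suc m) (D(Suc m := v)) = (heron_chain l m D)(m := sqrt (l m * D m - (v - (l m + D m))\<^sup>2 / 4) / 2)"
        using m by (auto simp: heron_chain_def heron_def fun_eq_iff power2_commute[of v])
      then show "(heron_chain l m D)(m := sqrt (l m * D m - (v - (l m + D m))\<^sup>2 / 4) / 2) \<notin> S \<Longrightarrow>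
        heron_chain l (Suc m) (D(Suc m := v)) \<notin> S" by simp
    qed
  qed
  have pred': "Measurable.pred (PiM (insert (Suc m) {1..m}) (\<lambda>_. lborel)) (\<lambda>D. heron_chain l (Suc m) D \<notin> S)"
    unfolding I2[symmetric] by measurable
  show ?case
    unfolding I2 by (rule AE_PiM_insert_iff[THEN iffD2, OF _ _ pred' AE_D]) auto
qed

text \<open>\<open>K n\<close> is a tube around the image. Centres from a countable dense subset of
  \<open>F\<close> suffice, so it is a countable union of boxes and measurable. A point in all tubes
  has approximating preimages, and compactness gives a limit in \<open>F\<close>. Both measurability
  of the image and its approximation from outside are used later.\<close>

lemma compact_image_PiM:
  fixes D :: "'i \<Rightarrow> 'a::euclidean_space \<Rightarrow> real"
  assumes F: "compact F" and D: "\<And>i. continuous_on UNIV (D i)" and I: "finite I" "I \<noteq> {}"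
  defines "K n \<equiv> {d \<in> I \<rightarrow>\<^sub>E UNIV. \<exists>y\<in>F. \<forall>i\<in>I. \<bar>d i - D i y\<bar> < 1 / real (Suc n)}"
  shows "K n \<in> sets (PiM I (\<lambda>_. lborel))" "(\<Inter>n. K n) = (\<lambda>y. \<lambda>i\<in>I. D i y) ` F"
proof -
  obtain Q where Q: "countable Q" "Q \<subseteq> F" "F \<subseteq> closure Q" using separable by blast
  have "K n = (\<Union>y\<in>Q. \<Pi>\<^sub>E i\<in>I. ball (D i y) (1 / real (Suc n)))"
  proof (intro equalityI subsetI)
    fix d assume "d \<in> K n"
    then obtain y where d: "d \<in> I \<rightarrow>\<^sub>E UNIV" and y: "y \<in> F" "\<And>i. i \<in> I \<Longrightarrow> \<bar>d i - D i y\<bar> < 1 / real (Suc n)"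
      by (auto simp: K_def)
    define U where "U = (\<Inter>i\<in>I. {y. \<bar>d i - D i y\<bar> < 1 / real (Suc n)})"
    have "open U" unfolding U_def using I
      by (intro open_INT) (auto intro!: open_Collect_less continuous_intros D)
    moreover have "y \<in> U" "y \<in> closure Q" using y Q by (auto simp: U_def)
    ultimately obtain z where "z \<in> Q" "z \<in> U" by (metis closure_iff_nhds_not_empty open_Int_closure_eq_empty disjoint_iff)
    then show "d \<in> (\<Union>y\<in>Q. \<Pi>\<^sub>E i\<in>I. ball (D i y) (1 / real (Suc n)))"
      using d by (auto simp: U_def dist_real_def abs_minus_commute intro!: bexI[of _ z] PiE_I dest: PiE_arb)
  next
    fix d assume "d \<in> (\<Union>y\<in>Q. \<Pi>\<^sub>E i\<in>I. ball (D i y) (1 / real (Suc n)))"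
    then obtain y where "y \<in> Q" "d \<in> (\<Pi>\<^sub>E i\<in>I. ball (D i y) (1 / real (Suc n)))" by blast
    then show "d \<in> K n" using Q(2)
      by (auto simp: K_def dist_real_def abs_minus_commute PiE_iff intro!: bexI[of _ y])
  qed
  also have "\<dots> \<in> sets (PiM I (\<lambda>_. lborel))"
    using Q(1) I by (intro sets.countable_UN' sets_PiM_I_finite) auto
  finally show "K n \<in> sets (PiM I (\<lambda>_. lborel))" .
  show "(\<Inter>n. K n) = (\<lambda>y. \<lambda>i\<in>I. D i y) ` F"
  proof (intro equalityI subsetI)
    fix d assume d: "d \<in> (\<Inter>n. K n)"
    then have "\<forall>n. \<exists>y. y \<in> F \<and> (\<forall>i\<in>I. \<bar>d i - D i y\<bar> < 1 / real (Suc n))"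
      unfolding K_def by blast
    then obtain y where y: "\<And>n. y n \<in> F" "\<And>n i. i \<in> I \<Longrightarrow> \<bar>d i - D i (y n)\<bar> < 1 / real (Suc n)"
      by metis
    obtain z r where z: "z \<in> F" "strict_mono r" "(y \<circ> r) \<longlonglongrightarrow> z"
      using F y(1) unfolding compact_def by blast
    have "d i = D i z" if i: "i \<in> I" for i
    proof (rule LIMSEQ_unique)
      show "(\<lambda>n. D i ((y \<circ> r) n)) \<longlonglongrightarrow> D i z"
        using D[of i] by (intro isCont_tendsto_compose[of z "D i", OF _ z(3)]) (auto simp: continuous_on_eq_continuous_at)
      have "(\<lambda>n. D i (y n)) \<longlonglongrightarrow> d i"
      proof (rule LIMSEQ_I)
        fix e :: real assume "e > 0"
        then obtain n0 where n0: "1 / real (Suc n0) < e" using nat_approx_posE by blast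
        have "norm (D i (y n) - d i) < e" if "n \<ge> n0" for n
        proof -
          have "norm (D i (y n) - d i) < 1 / real (Suc n)" using y(2)[OF i, of n] by (simp add: abs_minus_commute)
          also have "\<dots> \<le> 1 / real (Suc n0)" using that by (intro divide_left_mono) auto
          finally show ?thesis using n0 by simp
        qed
        then show "\<exists>n0. \<forall>n\<ge>n0. norm (D i (y n) - d i) < e" by blast
      qed
      from LIMSEQ_subseq_LIMSEQ[OF this z(2)] show "(\<lambda>n. D i ((y \<circ> r) n)) \<longlonglongrightarrow> d i" by (simp add: o_def)
    qed
    moreover have "d \<in> I \<rightarrow>\<^sub>E UNIV" using d by (auto simp: K_def)
    ultimately have "d = (\<lambda>i\<in>I. D i z)" by (auto simp: fun_eq_iff PiE_iff extensional_def)
    with z(1) show "d \<in> (\<lambda>y. \<lambda>i\<in>I. D i y) ` F" by blast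
  next
    fix d assume "d \<in> (\<lambda>y. \<lambda>i\<in>I. D i y) ` F"
    then obtain y where "y \<in> F" "d = (\<lambda>i\<in>I. D i y)" by blast
    then show "d \<in> (\<Inter>n. K n)" by (auto simp: K_def intro!: bexI[of _ y])
  qed
qed

section \<open>Lebesgue measure of images\<close>

text \<open>
  If the image were null, its neighbourhoods of radius \<open>1 / n\<close> would have small volume, and by
  Cauchy--Schwarz an image measure living on them has large energy at that scale.
\<close>

lemma lebesgue_image_pos:
  fixes D :: "'i \<Rightarrow> 'a::euclidean_space \<Rightarrow> real" and \<mu> :: "'a measure"
  assumes fin: "finite_measure \<mu>" and sets_mu [measurable_cong]: "sets \<mu> = sets borel"
    and F: "compact F" and supp: "emeasure \<mu> (- F) = 0" and nz: "emeasure \<mu> UNIV \<noteq> 0"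
    and D: "\<And>i. continuous_on UNIV (D i)" and I: "finite I" "I \<noteq> {}"
  defines "E n \<equiv> (\<integral>\<^sup>+y. (\<integral>\<^sup>+y'. ennreal (\<Prod>i\<in>I. exp (- (real n * (D i y - D i y'))\<^sup>2 / 2)) \<partial>\<mu>) \<partial>\<mu>)"
  assumes lim: "liminf (\<lambda>n. ennreal (real n ^ card I) * E n) \<noteq> \<infinity>"
  shows "0 < emeasure (PiM I (\<lambda>_. lborel)) ((\<lambda>y. \<lambda>i\<in>I. D i y) ` F)"
proof (rule ccontr)
  interpret finite_measure \<mu> by fact
  interpret L: product_sigma_finite "\<lambda>_::'i. lborel :: real measure" ..
  define \<Lambda> where "\<Lambda> = PiM I (\<lambda>_::'i. lborel :: real measure)"
  interpret L: sigma_finite_measure \<Lambda> unfolding \<Lambda>_def using I(1) by (rule L.sigma_finite)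
  interpret P: pair_sigma_finite \<Lambda> \<mu> ..
  have [measurable_cong]: "sets \<Lambda> = sets (PiM I (\<lambda>_. borel))"
    unfolding \<Lambda>_def by (intro sets_PiM_cong) auto
  have [measurable]: "D i \<in> borel_measurable borel" for i
    using D by (rule borel_measurable_continuous_onI)
  define K where "K n = {d \<in> I \<rightarrow>\<^sub>E UNIV. \<exists>y\<in>F. \<forall>i\<in>I. \<bar>d i - D i y\<bar> < 1 / real (Suc n)}" for n
  have K_sets [measurable]: "K n \<in> sets \<Lambda>" for n
    unfolding K_def \<Lambda>_def by (rule compact_image_PiM(1)[OF F D I])
  have K_Int: "(\<Inter>n. K n) = (\<lambda>y. \<lambda>i\<in>I. D i y) ` F"
    unfolding K_def by (rule compact_image_PiM(2)[OF F D I])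
  define k where "k = card I"
  define m where "m = measure \<mu> UNIV"
  have space_mu: "space \<mu> = UNIV" using sets_eq_imp_space_eq[OF sets_mu] by simp
  have m: "m > 0" "emeasure \<mu> UNIV = ennreal m"
    using nz by (auto simp: m_def emeasure_eq_measure zero_less_measure_iff)
  assume "\<not> 0 < emeasure (PiM I (\<lambda>_. lborel)) ((\<lambda>y. \<lambda>i\<in>I. D i y) ` F)"
  then have null: "emeasure \<Lambda> (\<Inter>n. K n) = 0" by (simp add: K_Int \<Lambda>_def)
  have main: "ennreal (2 ^ k * m\<^sup>2) \<le> ennreal (exp 2 ^ k) * (ennreal (real (Suc n) ^ k) * E (Suc n) * emeasure \<Lambda> (K n))" for n
  proof -
    define \<epsilon> where "\<epsilon> = 1 / real (Suc n)"
    have \<epsilon>: "\<epsilon> > 0" "real (Suc n) = 1 / \<epsilon>" by (auto simp: \<epsilon>_def)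
    \<comment> \<open>Indicator of the box of half-width \<open>\<epsilon>\<close> about the image
      of \<open>y\<close>. Its integral \<open>f\<close> over \<open>\<mu>\<close> is the image
      measure smoothed at scale \<open>\<epsilon>\<close>, without normalization, and is carried by
      \<open>K n\<close>.\<close>
    define b where "b y d = (\<Prod>i\<in>I. indicator {D i y - \<epsilon><..<D i y + \<epsilon>} (d i) :: ennreal)" for y and d :: "'i \<Rightarrow> real"
    have [measurable]: "(\<lambda>p. b (g p) (h p)) \<in> borel_measurable N"
      if g [measurable]: "g \<in> measurable N borel" and h: "h \<in> measurable N \<Lambda>" for N :: "'z measure" and g h
    proof -
      have [measurable]: "(\<lambda>p. h p i) \<in> borel_measurable N" if "i \<in> I" for i
        using measurable_compose[OF h[unfolded \<Lambda>_def] measurable_component_singleton[OF that]] by simp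
      have "b (g p) (h p) = (\<Prod>i\<in>I. if \<bar>h p i - D i (g p)\<bar> < \<epsilon> then 1 else 0)" for p
        unfolding b_def by (intro prod.cong) (auto simp: indicator_def abs_less_iff)
      then show ?thesis by simp
    qed
    define f where "f d = (\<integral>\<^sup>+y. b y d \<partial>\<mu>)" for d
    have [measurable]: "f \<in> borel_measurable \<Lambda>" unfolding f_def by measurable
    have f_K: "f d = f d * indicator (K n) d" if "d \<in> space \<Lambda>" for d
    proof (cases "d \<in> K n")
      case False
      have "AE y in \<mu>. y \<in> F"
        by (rule AE_I[of _ _ "- F"]) (use supp F in \<open>auto simp: sets_mu compact_imp_closed\<close>)
      then have "AE y in \<mu>. b y d = 0"
      proof eventually_elim
        fix y assume "y \<in> F"
        with False that obtain i where "i \<in> I" "\<not> \<bar>d i - D i y\<bar> < \<epsilon>"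
          by (auto simp: K_def \<epsilon>_def \<Lambda>_def space_PiM)
        then show "b y d = 0" unfolding b_def using I(1)
          by (intro prod_zero) (auto simp: indicator_def abs_less_iff intro!: bexI[of _ i])
      qed
      then have "f d = 0" unfolding f_def using that by (subst nn_integral_0_iff_AE) auto
      then show ?thesis by simp
    qed simp
    have f_int: "(\<integral>\<^sup>+d. f d \<partial>\<Lambda>) = ennreal ((2 * \<epsilon>) ^ k * m)"
    proof -
      have "(\<integral>\<^sup>+d. f d \<partial>\<Lambda>) = (\<integral>\<^sup>+y. (\<integral>\<^sup>+d. b y d \<partial>\<Lambda>) \<partial>\<mu>)"
        unfolding f_def by (rule P.Fubini'[symmetric]) measurable
      also have "\<dots> = (\<integral>\<^sup>+y. ennreal ((2 * \<epsilon>) ^ k) \<partial>\<mu>)"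
      proof (rule nn_integral_cong)
        fix y
        have "(\<integral>\<^sup>+d. b y d \<partial>\<Lambda>) = (\<Prod>i\<in>I. (\<integral>\<^sup>+u. indicator {D i y - \<epsilon><..<D i y + \<epsilon>} u \<partial>lborel))"
          unfolding b_def \<Lambda>_def by (rule L.product_nn_integral_prod) (use I in auto)
        also have "\<dots> = ennreal ((2 * \<epsilon>) ^ k)"
          using \<epsilon>(1) by (simp add: k_def ennreal_power)
        finally show "(\<integral>\<^sup>+d. b y d \<partial>\<Lambda>) = ennreal ((2 * \<epsilon>) ^ k)" .
      qed
      also have "\<dots> = ennreal ((2 * \<epsilon>) ^ k * m)"
        using \<epsilon> m by (simp add: space_mu ennreal_mult)
      finally show ?thesis .
    qed
    have f_sq: "(\<integral>\<^sup>+d. (f d)\<^sup>2 \<partial>\<Lambda>) \<le> ennreal ((2 * \<epsilon> * exp 2) ^ k) * E (Suc n)"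
    proof -
      have "(\<integral>\<^sup>+d. (f d)\<^sup>2 \<partial>\<Lambda>) = (\<integral>\<^sup>+d. (\<integral>\<^sup>+y. (\<integral>\<^sup>+y'. b y d * b y' d \<partial>\<mu>) \<partial>\<mu>) \<partial>\<Lambda>)"
      proof (rule nn_integral_cong)
        fix d assume [measurable]: "d \<in> space \<Lambda>"
        have "(\<integral>\<^sup>+y. (\<integral>\<^sup>+y'. b y d * b y' d \<partial>\<mu>) \<partial>\<mu>) = (\<integral>\<^sup>+y. b y d * f d \<partial>\<mu>)"
          unfolding f_def by (intro nn_integral_cong nn_integral_cmult) measurable
        also have "\<dots> = f d * f d" unfolding f_def by (rule nn_integral_multc) measurable
        finally show "(f d)\<^sup>2 = (\<integral>\<^sup>+y. (\<integral>\<^sup>+y'. b y d * b y' d \<partial>\<mu>) \<partial>\<mu>)" by (simp add: power2_eq_square)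
      qed
      also have "\<dots> = (\<integral>\<^sup>+y. (\<integral>\<^sup>+d. (\<integral>\<^sup>+y'. b y d * b y' d \<partial>\<mu>) \<partial>\<Lambda>) \<partial>\<mu>)"
        by (rule P.Fubini'[symmetric]) measurable
      also have "\<dots> = (\<integral>\<^sup>+y. (\<integral>\<^sup>+y'. (\<integral>\<^sup>+d. b y d * b y' d \<partial>\<Lambda>) \<partial>\<mu>) \<partial>\<mu>)"
        by (intro nn_integral_cong P.Fubini'[symmetric]) measurable
      also have "\<dots> \<le> (\<integral>\<^sup>+y. (\<integral>\<^sup>+y'. ennreal ((2 * \<epsilon> * exp 2) ^ k) *
          ennreal (\<Prod>i\<in>I. exp (- (real (Suc n) * (D i y - D i y'))\<^sup>2 / 2)) \<partial>\<mu>) \<partial>\<mu>)"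
      proof (intro nn_integral_mono)
        fix y y'
        have "(\<integral>\<^sup>+d. b y d * b y' d \<partial>\<Lambda>) = (\<integral>\<^sup>+d. (\<Prod>i\<in>I. indicator {D i y - \<epsilon><..<D i y + \<epsilon>} (d i) *
            indicator {D i y' - \<epsilon><..<D i y' + \<epsilon>} (d i) :: ennreal) \<partial>\<Lambda>)"
          by (simp add: b_def prod.distrib)
        also have "\<dots> = (\<Prod>i\<in>I. (\<integral>\<^sup>+u. indicator {D i y - \<epsilon><..<D i y + \<epsilon>} u *
            indicator {D i y' - \<epsilon><..<D i y' + \<epsilon>} u \<partial>lborel))"
          unfolding \<Lambda>_def by (rule L.product_nn_integral_prod) (use I in auto)
        also have "\<dots> \<le> (\<Prod>i\<in>I. ennreal (2 * \<epsilon> * exp 2 * exp (- (real (Suc n) * (D i y - D i y'))\<^sup>2 / 2)))"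
        proof (rule prod_mono_ennreal)
          fix i
          define t where "t = D i y - D i y'"
          show "(\<integral>\<^sup>+u. indicator {D i y - \<epsilon><..<D i y + \<epsilon>} u * indicator {D i y' - \<epsilon><..<D i y' + \<epsilon>} u \<partial>lborel)
            \<le> ennreal (2 * \<epsilon> * exp 2 * exp (- (real (Suc n) * (D i y - D i y'))\<^sup>2 / 2))"
          \<comment> \<open>Two boxes meet only if \<open>\<bar>t\<bar> < 2 * \<epsilon>\<close> in
            every coordinate. Then the Gaussian exponent is at least \<open>- 2\<close>, so
            \<open>exp 2\<close> makes the kernel dominate 1.\<close>
          proof (cases "\<bar>t\<bar> < 2 * \<epsilon>")
            case True
            then have "\<bar>t\<bar> * (1 / \<epsilon>) < 2" using \<epsilon>(1) by (simp add: field_simps)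
            then have "\<bar>t\<bar> * real (Suc n) < 2" by (simp only: \<epsilon>(2))
            then have "(\<bar>t\<bar> * real (Suc n))\<^sup>2 \<le> 2\<^sup>2" by (intro power_mono) auto
            then have "0 \<le> 2 + (- (real (Suc n) * t)\<^sup>2 / 2)" by (simp add: power_mult_distrib mult.commute)
            then have "1 \<le> exp (2 + (- (real (Suc n) * t)\<^sup>2 / 2))" by (simp only: one_le_exp_iff)
            then have "1 \<le> exp 2 * exp (- (real (Suc n) * t)\<^sup>2 / 2)" by (simp only: exp_add)
            then have "2 * \<epsilon> * 1 \<le> 2 * \<epsilon> * (exp 2 * exp (- (real (Suc n) * t)\<^sup>2 / 2))"
              using \<epsilon>(1) by (intro mult_left_mono) auto
            then have "ennreal (2 * \<epsilon>) \<le> ennreal (2 * \<epsilon> * exp 2 * exp (- (real (Suc n) * t)\<^sup>2 / 2))"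
              by (intro ennreal_leI) (simp add: mult.assoc)
            moreover have "(\<integral>\<^sup>+u. indicator {D i y - \<epsilon><..<D i y + \<epsilon>} u * indicator {D i y' - \<epsilon><..<D i y' + \<epsilon>} u \<partial>lborel)
              \<le> (\<integral>\<^sup>+u. indicator {D i y - \<epsilon><..<D i y + \<epsilon>} u \<partial>lborel)"
              by (intro nn_integral_mono) (auto simp: indicator_def)
            moreover have "\<dots> = ennreal (2 * \<epsilon>)" using \<epsilon>(1) by simp
            ultimately show ?thesis by (simp add: t_def)
          next
            case False
            then have "indicator {D i y - \<epsilon><..<D i y + \<epsilon>} u * indicator {D i y' - \<epsilon><..<D i y' + \<epsilon>} u = (0 :: ennreal)" for u
              by (auto simp: indicator_def t_def)
            then show ?thesis by (simp only:) simp
          qed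
        qed
        also have "\<dots> = ennreal ((2 * \<epsilon> * exp 2) ^ k) * ennreal (\<Prod>i\<in>I. exp (- (real (Suc n) * (D i y - D i y'))\<^sup>2 / 2))"
          using \<epsilon>(1) by (simp add: prod_ennreal prod.distrib k_def prod_nonneg flip: ennreal_mult)
        finally show "(\<integral>\<^sup>+d. b y d * b y' d \<partial>\<Lambda>) \<le> \<dots>" .
      qed
      also have "\<dots> = ennreal ((2 * \<epsilon> * exp 2) ^ k) * E (Suc n)"
        unfolding E_def by (simp add: nn_integral_cmult)
      finally show ?thesis .
    qed
    have "(ennreal ((2 * \<epsilon>) ^ k * m))\<^sup>2 = (\<integral>\<^sup>+d. f d * indicator (K n) d \<partial>\<Lambda>)\<^sup>2"
      unfolding f_int[symmetric] using f_K by (intro arg_cong[where f="\<lambda>x. x\<^sup>2"] nn_integral_cong)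
    also have "\<dots> \<le> (\<integral>\<^sup>+d. (f d)\<^sup>2 \<partial>\<Lambda>) * (\<integral>\<^sup>+d. (indicator (K n) d)\<^sup>2 \<partial>\<Lambda>)"
      by (rule Cauchy_Schwarz_nn_integral) auto
    also have "(\<integral>\<^sup>+d. (indicator (K n) d)\<^sup>2 \<partial>\<Lambda>) = (\<integral>\<^sup>+d. indicator (K n) d \<partial>\<Lambda>)"
      by (intro nn_integral_cong) (auto simp: indicator_def)
    also have "\<dots> = emeasure \<Lambda> (K n)" by simp
    also have "(\<integral>\<^sup>+d. (f d)\<^sup>2 \<partial>\<Lambda>) * emeasure \<Lambda> (K n) \<le> ennreal ((2 * \<epsilon> * exp 2) ^ k) * E (Suc n) * emeasure \<Lambda> (K n)"
      by (intro mult_right_mono f_sq) auto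
    \<comment> \<open>The factor is chosen to free the left side of \<open>\<epsilon>\<close> and to
      leave exactly \<open>real (Suc n) ^ k\<close> with the energy.\<close>
    finally have "ennreal (1 / (2 * \<epsilon>\<^sup>2) ^ k) * (ennreal ((2 * \<epsilon>) ^ k * m))\<^sup>2
      \<le> ennreal (1 / (2 * \<epsilon>\<^sup>2) ^ k) * (ennreal ((2 * \<epsilon> * exp 2) ^ k) * E (Suc n) * emeasure \<Lambda> (K n))"
      by (intro mult_left_mono) auto
    also have "ennreal (1 / (2 * \<epsilon>\<^sup>2) ^ k) * (ennreal ((2 * \<epsilon>) ^ k * m))\<^sup>2 = ennreal (2 ^ k * m\<^sup>2)"
    proof -
      have "1 / (2 * \<epsilon>\<^sup>2) ^ k * ((2 * \<epsilon>) ^ k * m)\<^sup>2 = 2 ^ k * m\<^sup>2"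
        using \<epsilon>(1) by (simp add: power_mult_distrib power2_eq_square)
      then show ?thesis using \<epsilon>(1) m(1) by (simp add: ennreal_power flip: ennreal_mult)
    qed
    also have "ennreal (1 / (2 * \<epsilon>\<^sup>2) ^ k) * (ennreal ((2 * \<epsilon> * exp 2) ^ k) * E (Suc n) * emeasure \<Lambda> (K n))
      = ennreal (1 / (2 * \<epsilon>\<^sup>2) ^ k * (2 * \<epsilon> * exp 2) ^ k) * (E (Suc n) * emeasure \<Lambda> (K n))"
      using \<epsilon>(1) by (subst ennreal_mult) (auto simp: mult.assoc)
    also have "1 / (2 * \<epsilon>\<^sup>2) ^ k * (2 * \<epsilon> * exp 2) ^ k = exp 2 ^ k * real (Suc n) ^ k"
      unfolding \<epsilon>(2) using \<epsilon>(1) by (simp add: power_mult_distrib power2_eq_square power_divide)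
    also have "ennreal (exp 2 ^ k * real (Suc n) ^ k) * (E (Suc n) * emeasure \<Lambda> (K n))
      = ennreal (exp 2 ^ k) * (ennreal (real (Suc n) ^ k) * E (Suc n) * emeasure \<Lambda> (K n))"
      by (subst ennreal_mult) (auto simp: mult.assoc)
    finally show ?thesis .
  qed
  have K_lim: "(\<lambda>n. emeasure \<Lambda> (K n)) \<longlonglongrightarrow> 0"
    unfolding null[symmetric]
  proof (rule Lim_emeasure_decseq)
    show "decseq K"
    proof (rule decseq_SucI, rule subsetI)
      fix n d assume "d \<in> K (Suc n)"
      moreover have "1 / real (Suc (Suc n)) \<le> 1 / real (Suc n)" by (simp add: field_simps)
      ultimately show "d \<in> K n" unfolding K_def by (blast intro: less_le_trans)
    qed
    fix n
    have "\<exists>B. \<forall>y\<in>F. \<bar>D i y\<bar> \<le> B" for i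
    proof -
      have "compact (D i ` F)" by (rule compact_continuous_image[OF continuous_on_subset[OF D] F]) simp
      then show ?thesis by (auto dest!: compact_imp_bounded simp: bounded_iff)
    qed
    then obtain B where B: "\<And>i y. y \<in> F \<Longrightarrow> \<bar>D i y\<bar> \<le> B i" by metis
    \<comment> \<open>Continuity from above needs finite measure; the tubes lie in a bounded box
      since each \<open>D i\<close> is bounded on \<open>F\<close>.\<close>
    have "K n \<subseteq> (\<Pi>\<^sub>E i\<in>I. {- (B i + 1)..B i + 1})"
    proof
      fix d assume "d \<in> K n"
      then obtain y where d: "d \<in> I \<rightarrow>\<^sub>E UNIV" and y: "y \<in> F" "\<And>i. i \<in> I \<Longrightarrow> \<bar>d i - D i y\<bar> < 1 / real (Suc n)"
        unfolding K_def by blast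
      have "d i \<in> {- (B i + 1)..B i + 1}" if "i \<in> I" for i
      proof -
        have "1 / real (Suc n) \<le> 1" by simp
        then show ?thesis using y(2)[OF that] B[OF y(1), of i] unfolding atLeastAtMost_iff by linarith
      qed
      then show "d \<in> (\<Pi>\<^sub>E i\<in>I. {- (B i + 1)..B i + 1})" using d by (auto simp: PiE_iff)
    qed
    then have "emeasure \<Lambda> (K n) \<le> emeasure \<Lambda> (\<Pi>\<^sub>E i\<in>I. {- (B i + 1)..B i + 1})"
      by (rule emeasure_mono) (use I in \<open>auto simp: \<Lambda>_def intro!: sets_PiM_I_finite\<close>)
    also have "\<dots> = (\<Prod>i\<in>I. emeasure lborel {- (B i + 1)..B i + 1})"
      unfolding \<Lambda>_def by (rule L.emeasure_PiM) (use I in auto)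
    also have "\<dots> < \<infinity>"
      by (simp add: less_top[symmetric] ennreal_prod_eq_top emeasure_lborel_Icc_eq)
    finally show "emeasure \<Lambda> (K n) \<noteq> \<infinity>" by simp
  qed auto
  obtain c where c: "c > 0" "liminf (\<lambda>n. ennreal (real n ^ k) * E n) < ennreal c"
  proof -
    obtain r where r: "r \<ge> 0" "liminf (\<lambda>n. ennreal (real n ^ k) * E n) = ennreal r"
      using lim unfolding k_def by (cases "liminf (\<lambda>n. ennreal (real n ^ card I) * E n)") auto
    show ?thesis by (rule that[of "r + 1"]) (use r in \<open>auto intro!: ennreal_lessI\<close>)
  qed
  \<comment> \<open>Chosen so that the right side of \<open>main\<close> falls to half of its left
    side.\<close>
  define \<delta> where "\<delta> = 2 ^ k * m\<^sup>2 / (2 * (exp 2 ^ k * c))"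
  have \<delta>: "\<delta> > 0" using c m by (simp add: \<delta>_def)
  have "\<forall>\<^sub>F n in sequentially. emeasure \<Lambda> (K n) < ennreal \<delta>"
    using order_tendstoD(2)[OF K_lim, of "ennreal \<delta>"] \<delta> by simp
  then obtain n0 where n0: "\<And>n. n \<ge> n0 \<Longrightarrow> emeasure \<Lambda> (K n) < ennreal \<delta>"
    unfolding eventually_sequentially by blast
  have "\<not> (\<forall>\<^sub>F n in sequentially. ennreal c \<le> ennreal (real n ^ k) * E n)"
    using c(2) Liminf_bounded[of "ennreal c" "\<lambda>n. ennreal (real n ^ k) * E n" sequentially] by (auto simp: not_le[symmetric])
  \<comment> \<open>A finite liminf controls the energy at infinitely many scales only. The bound
    \<open>Suc n0\<close> is due to \<open>main\<close>, which pairs scale \<open>Suc n'\<close>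
    with \<open>K n'\<close>.\<close>
  then obtain n where n: "n \<ge> Suc n0" "ennreal (real n ^ k) * E n < ennreal c"
    unfolding eventually_sequentially by (auto simp: not_le)
  then obtain n' where n': "n = Suc n'" "n' \<ge> n0" by (cases n) auto
  have "ennreal (2 ^ k * m\<^sup>2) \<le> ennreal (exp 2 ^ k) * (ennreal (real (Suc n') ^ k) * E (Suc n') * emeasure \<Lambda> (K n'))"
    by (rule main)
  also have "\<dots> \<le> ennreal (exp 2 ^ k) * (ennreal c * ennreal \<delta>)"
    using n n' n0[OF n'(2)] by (intro mult_left_mono mult_mono) (auto intro: less_imp_le)
  also have "\<dots> = ennreal (exp 2 ^ k * (c * \<delta>))"
    using c \<delta> by (simp flip: ennreal_mult)
  also have "exp 2 ^ k * (c * \<delta>) = 2 ^ k * m\<^sup>2 / 2"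
    using c by (simp add: \<delta>_def)
  finally have "2 ^ k * m\<^sup>2 \<le> 2 ^ k * m\<^sup>2 / 2" using m(1) by (subst (asm) ennreal_le_iff) auto
  moreover have "2 ^ k * m\<^sup>2 > 0" using m(1) by simp
  ultimately show False by linarith
qed

section \<open>Pinned area vectors\<close>

text \<open>Restriction only lowers ball masses, and all the subsets lie in the bounded set
  \<open>E\<close>; hence \<open>C\<close> and \<open>M\<close> are common to all of them, as
  \<open>frostman_pins\<close> demands.\<close>

lemma frostman_measure_restricted_ball_growth:
  assumes "frostman_measure s E \<mu>"
  obtains C M where "\<And>A. compact A \<Longrightarrow> A \<subseteq> E \<Longrightarrow> ball_growth (restricted_measure \<mu> A) C s"
    and "\<And>A. compact A \<Longrightarrow> A \<subseteq> E \<Longrightarrow> AE x in restricted_measure \<mu> A. norm x \<le> M"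
proof -
  have "compact E" and sets_mu: "sets \<mu> = sets borel" and fin: "finite_measure \<mu>"
    using assms by (auto simp: frostman_measure_def)
  obtain C where C: "\<And>x r. 0 < r \<Longrightarrow> measure \<mu> (ball x r) \<le> C * r powr s"
    using assms by (auto simp: frostman_measure_def)
  interpret finite_measure \<mu> by fact
  have em: "emeasure (restricted_measure \<mu> A) B = emeasure \<mu> (B \<inter> A)"
    if "compact A" "B \<in> sets borel" for A B
    using that by (intro emeasure_restricted_measure) (auto simp: sets_mu borel_compact)
  obtain M where M: "\<And>x. x \<in> E \<Longrightarrow> norm x \<le> M"
    using compact_imp_bounded[OF \<open>compact E\<close>] by (auto simp: bounded_iff)
  show ?thesis
  proof (rule that)
    fix A :: "'a set" assume A: "compact A" "A \<subseteq> E"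
    have A_sets [measurable]: "A \<in> sets \<mu>" using A by (simp add: sets_mu borel_compact)
    show "ball_growth (restricted_measure \<mu> A) C s"
    proof (intro ball_growth.intro ball_growth_axioms.intro finite_measureI)
      show "sets (restricted_measure \<mu> A) = sets borel" by (simp add: restricted_measure_def sets_mu)
      show "emeasure (restricted_measure \<mu> A) (space (restricted_measure \<mu> A)) \<noteq> \<infinity>"
        using em[OF A(1), of UNIV] sets_eq_imp_space_eq[OF sets_mu] by (simp add: restricted_measure_def)
      fix x :: 'a and r :: real assume "0 < r"
      have "emeasure (restricted_measure \<mu> A) (ball x r) = emeasure \<mu> (ball x r \<inter> A)"
        by (rule em) (use A in auto)
      also have "\<dots> \<le> emeasure \<mu> (ball x r)" by (rule emeasure_mono) (auto simp: sets_mu)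
      also have "\<dots> \<le> ennreal (C * r powr s)"
        unfolding emeasure_eq_measure by (intro ennreal_leI C \<open>0 < r\<close>)
      finally show "emeasure (restricted_measure \<mu> A) (ball x r) \<le> ennreal (C * r powr s)" .
    qed
    show "AE x in restricted_measure \<mu> A. norm x \<le> M"
      unfolding restricted_measure_def
      by (subst AE_density) (use A M in \<open>auto simp: indicator_def\<close>)
  qed
qed

theorem theorem3p5:
  fixes E :: "(real ^ 'n) set"
    and \<mu> :: "(real ^ 'n) measure"
    and F :: "nat \<Rightarrow> (real ^ 'n) set"
    and k :: nat and s :: real
  assumes "CARD('n) \<ge> 3"
    and "2 \<le> k" and "k < CARD('n)"
    and "compact E"
    and "hausdorff_dim E > ereal ((real CARD('n) + real k) / 2)"
    and "frostman_measure s E \<mu>"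
    and "s > (real CARD('n) + real k) / 2"
    and "\<And>i. i \<in> {1..k+1} \<Longrightarrow> compact (F i) \<and> F i \<subseteq> E \<and> emeasure \<mu> (F i) > 0"
    and "\<And>i j. i \<in> {1..k+1} \<Longrightarrow> j \<in> {1..k+1} \<Longrightarrow> i \<noteq> j \<Longrightarrow> setdist (F i) (F j) > 0"
  shows "AE x in PiM {1..k} (\<lambda>i. restricted_measure \<mu> (F i)).
           emeasure (PiM {1..<k} (\<lambda>_. lborel :: real measure))
             ((\<lambda>y. \<lambda>i\<in>{1..<k}. triangle_area (x i) (x (i + 1)) y) ` F (k + 1)) > 0"
proof -
  define I where "I = {1..k}"
  have I: "finite I" "I \<noteq> {}" "card I = k" and J: "finite {1..<k}" "{1..<k} \<noteq> {}"
    using \<open>2 \<le> k\<close> by (auto simp: I_def)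
  have F: "compact (F i)" "F i \<subseteq> E" "emeasure \<mu> (F i) > 0" if "i \<in> {1..k+1}" for i
    using assms(8)[OF that] by auto
  obtain C M where C: "\<And>A. compact A \<Longrightarrow> A \<subseteq> E \<Longrightarrow> ball_growth (restricted_measure \<mu> A) C s"
    and M: "\<And>A. compact A \<Longrightarrow> A \<subseteq> E \<Longrightarrow> AE x in restricted_measure \<mu> A. norm x \<le> M"
    using frostman_measure_restricted_ball_growth[OF assms(6)] by blast
  \<comment> \<open>Restricting to \<open>{}\<close> outside \<open>I\<close> supplies a measure
    with the required growth for every natural number, since \<open>F i\<close> is controlled only
    for \<open>i\<close> in \<open>{1..k+1}\<close>.\<close>
  define \<nu> where "\<nu> i = restricted_measure \<mu> (if i \<in> I then F i else {})" for i
  define \<mu>' where "\<mu>' = restricted_measure \<mu> (F (k + 1))"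
  interpret frostman_pins \<nu> \<mu>' C s M I
  proof (rule frostman_pins.intro)
    show "ball_growth (\<nu> i) C s" for i
      unfolding \<nu>_def by (rule C) (use F in \<open>auto simp: I_def\<close>)
    show "AE x in \<nu> i. norm x \<le> M" for i
      unfolding \<nu>_def by (rule M) (use F in \<open>auto simp: I_def\<close>)
    show "ball_growth \<mu>' C s" unfolding \<mu>'_def by (rule C) (use F in auto)
    show "AE x in \<mu>'. norm x \<le> M" unfolding \<mu>'_def by (rule M) (use F in auto)
    show "real DIM(real ^ 'n) + real (card I) < 2 * s" using assms(7) I(3) by simp
  qed (fact I)+
  have sets_mu: "sets \<mu> = sets borel" using assms(6) by (simp add: frostman_measure_def)
  have Fk: "compact (F (k + 1))" "F (k + 1) \<in> sets \<mu>"
    using F(1)[of "k + 1"] by (auto simp: sets_mu borel_compact)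
  have \<mu>'_F: "emeasure \<mu>' (- F (k + 1)) = 0" "emeasure \<mu>' UNIV \<noteq> 0"
    using F(3)[of "k + 1"] Fk unfolding \<mu>'_def
    by (subst emeasure_restricted_measure; auto simp: sets_mu borel_compact compact_imp_closed)+
  have "AE x in PiM I \<nu>. emeasure (PiM {1..<k} (\<lambda>_. lborel :: real measure))
      ((\<lambda>y. \<lambda>i\<in>{1..<k}. triangle_area (x i) (x (i + 1)) y) ` F (k + 1)) > 0"
    using AE_liminf_energy_finite
  proof eventually_elim
    fix x assume lim: "liminf (\<lambda>n. ennreal (real n ^ card I) * energy (real n) x) \<noteq> \<infinity>"
    define D where "D = (\<lambda>y. \<lambda>i\<in>I. (norm (y - x i))\<^sup>2) ` F (k + 1)"
    define S where "S = (\<lambda>y. \<lambda>i\<in>{1..<k}. triangle_area (x i) (x (i + 1)) y) ` F (k + 1)"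
    define l where "l i = (norm (x (i + 1) - x i))\<^sup>2" for i
    have D_cont: "continuous_on UNIV (\<lambda>y. (norm (y - x i))\<^sup>2)" for i by (intro continuous_intros)
    have S_cont: "continuous_on UNIV (triangle_area (x i) (x (i + 1)))" for i
      unfolding triangle_area_eq_gram by (intro continuous_intros) auto
    have D_pos: "0 < emeasure (PiM I (\<lambda>_. lborel)) D"
      unfolding D_def
      by (rule lebesgue_image_pos[OF base.finite_measure_axioms base.sets_eq Fk(1) \<mu>'_F D_cont I(1,2)])
         (use lim in \<open>simp add: energy_def\<close>)
    \<comment> \<open>\<open>emeasure\<close> is 0 on non-measurable sets, so measurability of
      \<open>S\<close> is needed before a zero value can be read as a null set.\<close>
    have S_sets: "S \<in> sets (PiM {1..<k} (\<lambda>_. lborel))"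
      unfolding S_def compact_image_PiM(2)[OF Fk(1) S_cont J, symmetric]
      by (intro sets.countable_INT' image_subsetI compact_image_PiM(1)[OF Fk(1) S_cont J]
          countableI_type UNIV_not_empty)
    have D_S: "heron_chain l k d \<in> S" if d: "d \<in> D" for d
    proof -
      obtain y where y: "y \<in> F (k + 1)" "d = (\<lambda>i\<in>I. (norm (y - x i))\<^sup>2)"
        using d unfolding D_def by blast
      have "heron_chain l k d = (\<lambda>i\<in>{1..<k}. triangle_area (x i) (x (i + 1)) y)"
        using y(2) by (auto simp: heron_chain_def triangle_area_eq_heron l_def I_def fun_eq_iff)
      then show ?thesis using y(1) by (auto simp: S_def)
    qed
    have "emeasure (PiM {1..<k} (\<lambda>_. lborel)) S \<noteq> 0"
    proof
      assume "emeasure (PiM {1..<k} (\<lambda>_. lborel)) S = 0"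
      with S_sets have "S \<in> null_sets (PiM {1..<k} (\<lambda>_. lborel))" by blast
      then have "AE d in PiM I (\<lambda>_. lborel). heron_chain l k d \<notin> S"
        unfolding I_def using \<open>2 \<le> k\<close> by (intro AE_heron_chain) auto
      then have "AE d in PiM I (\<lambda>_. lborel). d \<notin> D" by eventually_elim (use D_S in blast)
      \<comment> \<open>The same convention read backwards: a set of positive
        \<open>emeasure\<close> is measurable.\<close>
      moreover have "D \<in> sets (PiM I (\<lambda>_. lborel))"
        using D_pos emeasure_notin_sets by fastforce
      ultimately have "D \<in> null_sets (PiM I (\<lambda>_. lborel))" by (simp add: AE_iff_null_sets)
      then show False using D_pos by auto
    qed
    then show "emeasure (PiM {1..<k} (\<lambda>_. lborel :: real measure))
      ((\<lambda>y. \<lambda>i\<in>{1..<k}. triangle_area (x i) (x (i + 1)) y) ` F (k + 1)) > 0"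
      by (simp add: S_def zero_less_iff_neq_zero)
  qed
  moreover have "PiM I \<nu> = PiM {1..k} (\<lambda>i. restricted_measure \<mu> (F i))"
    by (intro PiM_cong) (auto simp: I_def \<nu>_def)
  ultimately show ?thesis by (simp only:)
qed

end
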